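(* Let $\mathscr{F}$ be a codimension one $\mathscr{L}$-foliation on $\mathbf{C}\mathbf{P}(n)$ associated with a regular Lie algebra $\mathscr{L}\subset\chi(\mathbf{C}\mathbf{P}(n))$. If $\mathscr{L}$ is solvable, then $\mathscr{F}$ has an invariant hyperplane $\mathscr{H}$. In particular, there is an affine chart $\mathbf{C}^n\simeq\mathbf{C}\mathbf{P}(n)\setminus\mathscr{H}$ in which the elements of $\mathscr{L}$ are affine vector fields.
   Context: A codimension one foliation $\mathscr{F}$ on $\mathbf{C}\mathbf{P}(n)$ is given in homogeneous coordinates by a $1$-form $\omega=\sum_{k=0}^nA_kdz_k$ on $\mathbf{C}^{n+1}$, with $A_k$ homogeneous polynomials of the same degree, $\omega\wedge d\omega=0$, $\sum z_kA_k=0$, and $\{A_0=\dots=A_n=0\}$ of codimension $\geq2$; $\mathrm{Sing}\,\mathscr{F}$ is the image in $\mathbf{C}\mathbf{P}(n)$ of $\{A_0=\dots=A_n=0\}\setminus\{0\}$. Let $\chi(\mathbf{C}\mathbf{P}(n))$ be the Lie algebra of holomorphic vector fields on $\mathbf{C}\mathbf{P}(n)$. $\mathscr{F}$ is an $\mathscr{L}$-foliation (associated with $\mathscr{L}$) if $\mathscr{L}\subset\chi(\mathbf{C}\mathbf{P}(n))$ is a Lie subalgebra such that, for generic $z$, $\mathscr{L}(z)=\{X(z):X\in\mathscr{L}\}$ is the tangent space at $z$ to the leaf of $\mathscr{F}$; $\mathscr{L}$ is always taken maximal for this property, i.e. it is the algebra of all holomorphic vector fields on $\mathbf{C}\mathbf{P}(n)$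 tangent to $\mathscr{F}$. $\mathscr{L}$ is called regular if $\dim\mathscr{L}(m)=n-1$ for every $m\in\mathbf{C}\mathbf{P}(n)\setminus\mathrm{Sing}\,\mathscr{F}$. A hyperplane $\mathscr{H}$ is invariant by $\mathscr{F}$ if $\mathscr{H}\setminus\mathrm{Sing}\,\mathscr{F}$ is a leaf of $\mathscr{F}$. *)

theory Defs
  imports "HOL-Analysis.Analysis" "HOL-Library.Function_Algebras"
begin

text \<open>
  Throughout \<open>n = CARD('m)\<close>, so that \<open>n \<ge> 1\<close>; \<open>\<complex>\<^sup>n\<close> is \<^typ>\<open>complex^'m\<close>
  and \<open>\<complex>\<^sup>n\<^sup>+\<^sup>1\<close>, with the homogeneous coordinates, is \<^typ>\<open>complex^'m option\<close>.
\<close>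

section \<open>Calculus and polynomials on complex coordinate spaces\<close>

text \<open>The derivative at \<open>x\<close> in the complex direction \<open>v\<close>, taken componentwise.\<close>

definition dir_deriv :: "(complex^'a \<Rightarrow> complex^'b) \<Rightarrow> complex^'a \<Rightarrow> complex^'a \<Rightarrow> complex^'b" where
  "dir_deriv f x v = (\<chi> i. deriv (\<lambda>t. f (x + t *s v) $ i) 0)"

definition entire_map :: "(complex^'a \<Rightarrow> complex^'b) \<Rightarrow> bool" where
  "entire_map f \<longleftrightarrow>
     (\<forall>x. \<exists>D. Vector_Spaces.linear (*s) (*s) D \<and> (f has_derivative D) (at x))"

definition monomial_fun :: "('a::finite \<Rightarrow> nat) \<Rightarrow> complex^'a \<Rightarrow> complex" where
  "monomial_fun \<alpha> z = (\<Prod>k\<in>UNIV. (z $ k) ^ \<alpha> k)"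

definition poly_fun :: "(complex^'a \<Rightarrow> complex) \<Rightarrow> bool" where
  "poly_fun f \<longleftrightarrow>
     (\<exists>d c. \<forall>z. f z = (\<Sum>\<alpha> | (\<Sum>k\<in>UNIV. \<alpha> k) \<le> d. c \<alpha> * monomial_fun \<alpha> z))"

definition homogeneous_poly :: "nat \<Rightarrow> (complex^'a \<Rightarrow> complex) \<Rightarrow> bool" where
  "homogeneous_poly d f \<longleftrightarrow>
     (\<exists>c. \<forall>z. f z = (\<Sum>\<alpha> | (\<Sum>k\<in>UNIV. \<alpha> k) = d. c \<alpha> * monomial_fun \<alpha> z))"

section \<open>Codimension of algebraic sets\<close>

definition algebraic_set :: "(complex^'a) set \<Rightarrow> bool" where
  "algebraic_set S \<longleftrightarrow> (\<exists>P. (\<forall>p\<in>P. poly_fun p) \<and> S = {z. \<forall>p\<in>P. p z = 0})"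

definition irreducible_algebraic :: "(complex^'a) set \<Rightarrow> bool" where
  "irreducible_algebraic S \<longleftrightarrow> algebraic_set S \<and> S \<noteq> {} \<and>
     (\<forall>S1 S2. algebraic_set S1 \<and> algebraic_set S2 \<and> S = S1 \<union> S2 \<longrightarrow> S = S1 \<or> S = S2)"

text \<open>
  Krull codimension in the ambient affine space: every irreducible closed subset of \<open>Z\<close>
  is the bottom of a strictly increasing chain of irreducible closed sets of length \<open>r\<close>.
\<close>

definition codim_ge :: "nat \<Rightarrow> (complex^'a) set \<Rightarrow> bool" where
  "codim_ge r Z \<longleftrightarrow>
     (\<forall>W. irreducible_algebraic W \<and> W \<subseteq> Z \<longrightarrow>
        (\<exists>C. C 0 = W \<and> (\<forall>i\<le>r. irreducible_algebraic (C i)) \<and> (\<forall>i<r. C i \<subset> C (Suc i))))"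

section \<open>Projective space and its affine charts\<close>

text \<open>The points of \<open>CP(n)\<close> are the complex lines through the origin of \<open>\<complex>\<^sup>n\<^sup>+\<^sup>1\<close>.\<close>

definition proj_point :: "complex^('m::finite) option \<Rightarrow> (complex^'m option) set" where
  "proj_point z = vec.span {z}"

definition CP :: "(complex^('m::finite) option) set set" where
  "CP = proj_point ` (- {0})"

text \<open>
  The chart domain of index \<open>k\<close> is \<open>z\<^sub>k \<noteq> 0\<close>; its affine coordinates are the quotients
  \<open>z\<^sub>j / z\<^sub>k\<close> for \<open>j \<noteq> k\<close>. They are indexed by \<open>'m\<close> through the bijection \<open>slot k\<close> from \<open>'m\<close>
  onto the indices different from \<open>k\<close>.
  \<open>hom_coord k\<close> is the inverse chart, in homogeneous coordinates with \<open>z\<^sub>k = 1\<close>.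
\<close>

definition slot :: "'m option \<Rightarrow> 'm \<Rightarrow> 'm option" where
  "slot k i = (if Some i = k then None else Some i)"

definition aff_coord :: "'m option \<Rightarrow> complex^('m::finite) option \<Rightarrow> complex^'m" where
  "aff_coord k z = (\<chi> i. z $ slot k i / z $ k)"

definition hom_coord :: "'m option \<Rightarrow> complex^'m \<Rightarrow> complex^('m::finite) option" where
  "hom_coord k x = (\<chi> j. if j = k then 1 else x $ (THE i. slot k i = j))"

definition hyperplane :: "(complex^('m::finite) option) set set \<Rightarrow> bool" where
  "hyperplane H \<longleftrightarrow>
     (\<exists>a::complex^'m option. a \<noteq> 0 \<and> H = {p \<in> CP. p \<subseteq> {z. (\<Sum>k\<in>UNIV. a $ k * z $ k) = 0}})"

section \<open>Holomorphic vector fields on projective space\<close>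

text \<open>
  A vector field is given by its expressions in the \<open>n + 1\<close> affine charts, subject to
  the transformation rule under the changes of charts.
\<close>

type_synonym 'm chart_field = "'m option \<Rightarrow> complex^'m \<Rightarrow> complex^'m"

definition holo_vector_fields :: "('m::finite) chart_field set" where
  "holo_vector_fields =
     {X. (\<forall>k. entire_map (X k)) \<and>
         (\<forall>k l x. hom_coord k x $ l \<noteq> 0 \<longrightarrow>
            X l (aff_coord l (hom_coord k x))
              = dir_deriv (\<lambda>y. aff_coord l (hom_coord k y)) x (X k x))}"

definition vf_scale :: "complex \<Rightarrow> ('m::finite) chart_field \<Rightarrow> 'm chart_field" where
  "vf_scale c X = (\<lambda>k x. c *s X k x)"

global_interpretation vf: vector_space vf_scale
  by unfold_locales (auto simp: vf_scale_def fun_eq_iff vec_eq_iff algebra_simps)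

definition vf_bracket :: "('m::finite) chart_field \<Rightarrow> 'm chart_field \<Rightarrow> 'm chart_field" where
  "vf_bracket X Y = (\<lambda>k x. dir_deriv (Y k) x (X k x) - dir_deriv (X k) x (Y k x))"

definition lie_subalgebra :: "('m::finite) chart_field set \<Rightarrow> bool" where
  "lie_subalgebra L \<longleftrightarrow> L \<subseteq> holo_vector_fields \<and> vf.subspace L \<and>
     (\<forall>X\<in>L. \<forall>Y\<in>L. vf_bracket X Y \<in> L)"

fun derived_series :: "('m::finite) chart_field set \<Rightarrow> nat \<Rightarrow> 'm chart_field set" where
  "derived_series L 0 = L"
| "derived_series L (Suc i) =
     vf.span {vf_bracket X Y | X Y. X \<in> derived_series L i \<and> Y \<in> derived_series L i}"

definition solvable_lie :: "('m::finite) chart_field set \<Rightarrow> bool" where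
  "solvable_lie L \<longleftrightarrow> (\<exists>i. derived_series L i = {0})"

text \<open>The value \<open>L(m)\<close> at the point \<open>m\<close> with coordinates \<open>x\<close> in the chart \<open>k\<close>.\<close>

definition vf_values :: "('m::finite) chart_field set \<Rightarrow> 'm option \<Rightarrow> complex^'m \<Rightarrow> (complex^'m) set" where
  "vf_values L k x = {X k x | X. X \<in> L}"

section \<open>Codimension one foliations\<close>

text \<open>The 1-form \<open>\<omega> = \<Sum> A\<^sub>k dz\<^sub>k\<close> is represented by its coefficient map \<open>A\<close>.\<close>

definition one_form :: "(complex^'a \<Rightarrow> complex^'a) \<Rightarrow> complex^'a \<Rightarrow> complex^'a \<Rightarrow> complex" where
  "one_form A z u = (\<Sum>k\<in>UNIV. A z $ k * u $ k)"

text \<open>\<open>d\<omega> = \<Sum> dA\<^sub>k \<and> dz\<^sub>k\<close>.\<close>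

definition ext_deriv ::
    "(complex^'a \<Rightarrow> complex^'a) \<Rightarrow> complex^'a \<Rightarrow> complex^'a \<Rightarrow> complex^'a \<Rightarrow> complex" where
  "ext_deriv A z u v =
     (\<Sum>k\<in>UNIV. dir_deriv A z u $ k * v $ k - dir_deriv A z v $ k * u $ k)"

definition wedge_one_two ::
    "('v \<Rightarrow> complex) \<Rightarrow> ('v \<Rightarrow> 'v \<Rightarrow> complex) \<Rightarrow> 'v \<Rightarrow> 'v \<Rightarrow> 'v \<Rightarrow> complex" where
  "wedge_one_two \<alpha> \<beta> u v w = \<alpha> u * \<beta> v w - \<alpha> v * \<beta> u w + \<alpha> w * \<beta> u v"

definition foliation :: "(complex^('m::finite) option \<Rightarrow> complex^'m option) \<Rightarrow> bool" where
  "foliation A \<longleftrightarrow>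
     (\<exists>d. \<forall>k. homogeneous_poly d (\<lambda>z. A z $ k)) \<and>
     (\<forall>z u v w. wedge_one_two (one_form A z) (ext_deriv A z) u v w = 0) \<and>
     (\<forall>z. (\<Sum>k\<in>UNIV. z $ k * A z $ k) = 0) \<and>
     codim_ge 2 {z. A z = 0}"

definition Sing :: "(complex^('m::finite) option \<Rightarrow> complex^'m option) \<Rightarrow> (complex^'m option) set set" where
  "Sing A = proj_point ` ({z. A z = 0} - {0})"

text \<open>The tangent space to the leaf through the nonsingular point with coordinates \<open>x\<close> in the
  chart \<open>k\<close> is the kernel of the pull-back of \<open>\<omega>\<close> to this chart.\<close>

definition leaf_tangent ::
    "(complex^('m::finite) option \<Rightarrow> complex^'m option) \<Rightarrow> 'm option \<Rightarrow> complex^'m \<Rightarrow> (complex^'m) set" where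
  "leaf_tangent A k x = {v. one_form A (hom_coord k x) (dir_deriv (hom_coord k) x v) = 0}"

text \<open>
  The leaf through \<open>p\<close> consists of the end points of the piecewise \<open>C\<^sup>1\<close> paths issued from \<open>p\<close>
  and tangent to the foliation outside the singular set. A path in \<open>CP(n)\<close> is represented by a
  lift to \<open>\<complex>\<^sup>n\<^sup>+\<^sup>1\<close>; the tangency does not depend on the lift because the \<open>A\<^sub>k\<close> are homogeneous
  of the same degree and \<open>\<Sum> z\<^sub>k A\<^sub>k = 0\<close>.
\<close>

definition tangent_path ::
    "(complex^('m::finite) option \<Rightarrow> complex^'m option) \<Rightarrow> (real \<Rightarrow> complex^'m option) \<Rightarrow> bool" where
  "tangent_path A \<gamma> \<longleftrightarrow> valid_path \<gamma> \<and>
     (\<forall>t\<in>{0..1}. \<gamma> t \<noteq> 0 \<and> A (\<gamma> t) \<noteq> 0) \<and>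
     (\<forall>t\<in>{0..1}. \<forall>v. (\<gamma> has_vector_derivative v) (at t within {0..1}) \<longrightarrow>
        one_form A (\<gamma> t) v = 0)"

definition leaf_through ::
    "(complex^('m::finite) option \<Rightarrow> complex^'m option) \<Rightarrow> (complex^'m option) set \<Rightarrow> (complex^'m option) set set"
  where
  "leaf_through A p =
     {proj_point (pathfinish \<gamma>) | \<gamma>. tangent_path A \<gamma> \<and> proj_point (pathstart \<gamma>) = p}"

definition is_leaf ::
    "(complex^('m::finite) option \<Rightarrow> complex^'m option) \<Rightarrow> (complex^'m option) set set \<Rightarrow> bool" where
  "is_leaf A S \<longleftrightarrow> (\<exists>p \<in> CP - Sing A. S = leaf_through A p)"

definition invariant_hyperplane ::
    "(complex^('m::finite) option \<Rightarrow> complex^'m option) \<Rightarrow> (complex^'m option) set set \<Rightarrow> bool" where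
  "invariant_hyperplane A H \<longleftrightarrow> hyperplane H \<and> is_leaf A (H - Sing A)"

definition tangent_fields ::
    "(complex^('m::finite) option \<Rightarrow> complex^'m option) \<Rightarrow> 'm chart_field set" where
  "tangent_fields A = {X \<in> holo_vector_fields. \<forall>k x. X k x \<in> leaf_tangent A k x}"

text \<open>``Generic'' means: on the complement of a hypersurface \<open>g = 0\<close> of \<open>CP(n)\<close>.\<close>

definition L_foliation ::
    "(complex^('m::finite) option \<Rightarrow> complex^'m option) \<Rightarrow> 'm chart_field set \<Rightarrow> bool" where
  "L_foliation A L \<longleftrightarrow> foliation A \<and> lie_subalgebra L \<and>
     (\<exists>d g. homogeneous_poly d g \<and> (\<exists>z. g z \<noteq> 0) \<and>
        (\<forall>k x. g (hom_coord k x) \<noteq> 0 \<and> A (hom_coord k x) \<noteq> 0 \<longrightarrow>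
           vf_values L k x = leaf_tangent A k x)) \<and>
     L = tangent_fields A"

definition regular_lie ::
    "(complex^('m::finite) option \<Rightarrow> complex^'m option) \<Rightarrow> 'm chart_field set \<Rightarrow> bool" where
  "regular_lie A L \<longleftrightarrow>
     (\<forall>m \<in> CP - Sing A. \<forall>k x. m = proj_point (hom_coord k x) \<longrightarrow>
        vec.dim (vf_values L k x) = CARD('m) - 1)"

section \<open>Affine charts\<close>

text \<open>
  The inverse of the affine chart of \<open>CP(n)\<close> obtained from the standard one by the linear
  change of homogeneous coordinates \<open>M\<close>, in homogeneous coordinates: \<open>x \<mapsto> M (1, x)\<close>.
\<close>

definition affine_param ::
    "complex^('m::finite) option^'m option \<Rightarrow> complex^'m \<Rightarrow> complex^'m option" where
  "affine_param M x = M *v hom_coord None x"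

definition affine_chart_onto ::
    "complex^('m::finite) option^'m option \<Rightarrow> (complex^'m option) set set \<Rightarrow> bool" where
  "affine_chart_onto M U \<longleftrightarrow> invertible M \<and> bij_betw (\<lambda>x. proj_point (affine_param M x)) UNIV U"

text \<open>\<open>Y\<close> is the expression of \<open>X\<close> in the affine chart given by \<open>M\<close>.\<close>

definition expressed_as ::
    "complex^('m::finite) option^'m option \<Rightarrow> 'm chart_field \<Rightarrow> (complex^'m \<Rightarrow> complex^'m) \<Rightarrow> bool" where
  "expressed_as M X Y \<longleftrightarrow>
     (\<forall>k x. affine_param M x $ k \<noteq> 0 \<longrightarrow>
        X k (aff_coord k (affine_param M x))
          = dir_deriv (\<lambda>y. aff_coord k (affine_param M y)) x (Y x))"

definition affine_field :: "(complex^'m \<Rightarrow> complex^'m) \<Rightarrow> bool" where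
  "affine_field Y \<longleftrightarrow> (\<exists>B b. \<forall>x. Y x = B *v x + b)"

end

theory Submission
  imports Defs "HOL-Complex_Analysis.Cauchy_Integral_Formula"
    "HOL-Computational_Algebra.Fundamental_Theorem_Algebra"
begin

text \<open>
  A holomorphic vector field on \<open>CP(n)\<close> is induced by a linear vector field \<open>z \<mapsto> B z\<close> of
  \<open>\<complex>\<^sup>n\<^sup>+\<^sup>1\<close>, and \<open>B\<close> is unique up to a scalar matrix (\<open>holo_vector_fields_linear\<close>,
  \<open>linear_field_eq_0\<close>). Hence \<open>L\<close> lifts to the Lie algebra \<open>\<gg>\<close> of all matrices \<open>B\<close> with
  \<open>\<omega>\<^sub>z(B z) = 0\<close> for every \<open>z\<close> (\<open>tangent_matrices\<close>), and \<open>\<gg>\<close> is solvable when \<open>L\<close> is. Lie's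
  theorem (\<open>lie_common_eigenvector\<close>), applied to the transposed matrices, gives a linear form
  \<open>a \<noteq> 0\<close> with \<open>a(B z) = \<lambda>(B) a(z)\<close> for all \<open>B \<in> \<gg>\<close>. The hyperplane is \<open>H = {a = 0}\<close>. In the
  affine chart \<open>a = 1\<close> the field of \<open>B\<close> is the projection of \<open>B z - \<lambda>(B) z\<close>, which is tangent to
  the affine hyperplane \<open>a = 1\<close> and therefore affine
  (\<open>linear_field_affine_expression\<close>).

  That \<open>H\<close> minus the singular set is tangent to the foliation is where regularity enters: at a
  nonsingular point \<open>z\<close> with \<open>a(z) = 0\<close> the vectors \<open>B z\<close> with \<open>B \<in> \<gg>\<close> lie both in \<open>ker a\<close> and in
  \<open>ker \<omega>\<^sub>z\<close>, and by regularity they fill a space of dimension \<open>n\<close>, so the two kernels agree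
  (\<open>hyperplane_spanned\<close>). It remains to see that \<open>H\<close> minus the singular set is one single leaf.

  \<^item> It is connected by tangent paths. The singular set does not contain \<open>ker a\<close>, because it
    has codimension at least two while every irreducible algebraic set strictly above a hyperplane
    is the whole space (\<open>codim_two_hyperplane\<close>). On the complex line joining two nonsingular
    points of \<open>ker a\<close> only finitely many points are singular, and the complement of a finite set
    in \<open>\<complex>\<close> is connected.

  \<^item> A tangent path that starts in \<open>H\<close> stays in \<open>H\<close>. A comparison argument of Gronwall type
    would not suffice: the derivative of a piecewise \<open>C\<^sup>1\<close> path may be unbounded near the
    exceptional parameters, and the path may have infinite length there. A first integral is needed
    (\<open>local_first_integral\<close>). It is read off from the map
    \<open>s \<mapsto> exp(s\<^sub>1 B\<^sub>1) \<dots> exp(s\<^sub>n B\<^sub>n) (z\<^sub>0 + \<epsilon> e)\<close> with \<open>B\<^sub>i \<in> \<gg>\<close>, a local diffeomorphism near a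
    nonsingular point \<open>z\<^sub>0\<close> of \<open>ker a\<close>: its partial derivatives in the directions \<open>s\<^sub>i\<close> are tangent
    to the foliation since \<open>\<gg>\<close> is stable under conjugation by \<open>exp(s B)\<close>
    (\<open>mexp_conj_tangent\<close>), so the coordinate \<open>\<epsilon>\<close> is constant along tangent paths by continuity, and
    \<open>\<epsilon> = 0\<close> describes \<open>ker a\<close>.
\<close>

section \<open>Common eigenvectors of solvable matrix Lie algebras\<close>

lemma mat_mult_vec: "mat c *v w = c *s (w :: complex^'n)"
  by (simp add: vec_eq_iff matrix_vector_mult_def mat_def if_distrib if_distribR cong: if_cong)

lemma commutator_shift:
  fixes X Y :: "complex^'n^'n"
  shows "(X - mat c) ** Y - Y ** (X - mat c) = X ** Y - Y ** X"
  by (simp add: matrix_eq matrix_vector_mult_diff_rdistrib matrix_vector_mul_assoc[symmetric]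
      matrix_vector_mult_diff_distrib mat_mult_vec vector_scalar_commute)

text \<open>The least such \<open>k\<close> plays the role of the degree of a minimal polynomial: for \<open>e i = Y\<^sup>i v\<close> it is the
  dimension of the cyclic subspace generated by \<open>v\<close>.\<close>

lemma sequence_dependent:
  fixes e :: "nat \<Rightarrow> complex^'n"
  obtains k where "e k \<in> vec.span (e ` {..<k})" "\<And>j. j < k \<Longrightarrow> e j \<notin> vec.span (e ` {..<j})"
proof -
  have "\<exists>k. e k \<in> vec.span (e ` {..<k})"
  proof (rule ccontr)
    assume "\<not> ?thesis"
    hence new: "e k \<notin> vec.span (e ` {..<k})" for k by blast
    have "vec.independent (e ` {..<k}) \<and> card (e ` {..<k}) = k" for k
    proof (induction k)
      case (Suc k)
      have "e k \<notin> e ` {..<k}" using new[of k] vec.span_base[of "e k" "e ` {..<k}"] by blast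
      moreover have "vec.independent (insert (e k) (e ` {..<k}))"
        using Suc new[of k] by (intro vec.independent_insertI) auto
      ultimately show ?case using Suc by (simp add: lessThan_Suc)
    qed (simp add: vec.independent_empty)
    hence "Suc CARD('n) \<le> vec.dim (UNIV :: (complex^'n) set)"
      using vec.independent_card_le_dim[of "e ` {..<Suc CARD('n)}" UNIV] by simp
    thus False unfolding vec_dim_card by simp
  qed
  hence "e (LEAST k. e k \<in> vec.span (e ` {..<k})) \<in> vec.span (e ` {..<LEAST k. e k \<in> vec.span (e ` {..<k})})"
    by (rule LeastI_ex)
  moreover have "e j \<notin> vec.span (e ` {..<j})" if "j < (LEAST k. e k \<in> vec.span (e ` {..<k}))" for j
    using not_less_Least[OF that] .
  ultimately show thesis using that by blast
qed

text \<open>Evaluate polynomials at \<open>X\<close> on the vector \<open>w\<close>. A nonzero polynomial \<open>q\<close> of minimal degree with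
  \<open>q(X) w = 0\<close> has a root \<open>r\<close>; writing \<open>q = (x - r) h\<close>, minimality makes \<open>h(X) w\<close> a nonzero vector,
  and it is an eigenvector for \<open>r\<close>.\<close>

lemma eigenvector_in_invariant_subspace:
  fixes X :: "complex^'n^'n"
  assumes W: "vec.subspace W" and w: "w \<in> W" "w \<noteq> 0" and inv: "\<And>u. u \<in> W \<Longrightarrow> X *v u \<in> W"
  shows "\<exists>v c. v \<in> W \<and> v \<noteq> 0 \<and> X *v v = c *s v"
proof -
  define ev where "ev p = fold_coeffs (\<lambda>a u. a *s w + X *v u) p 0" for p
  have ev0: "ev 0 = 0" by (simp add: ev_def)
  have evC: "ev (pCons a p) = a *s w + X *v ev p" for a p
    unfolding ev_def
    by (cases "p = 0 \<and> a = 0") (auto simp: fold_coeffs_pCons_not_0_0_eq)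
  have evadd: "ev (p + q) = ev p + ev q" for p q
    by (induction p q rule: poly_induct2)
      (simp_all add: ev0 evC vec.scale_left_distrib matrix_vector_right_distrib)
  have evsmult: "ev (smult c p) = c *s ev p" for c p
    by (induction p) (simp_all add: ev0 evC vec.scale_right_distrib vector_scalar_commute)
  have evW: "ev p \<in> W" for p
  proof (induction p)
    case (pCons a p)
    then show ?case unfolding evC
      by (intro vec.subspace_add[OF W] vec.subspace_scale[OF W] w inv)
  qed (simp add: ev0 vec.subspace_0[OF W])
  obtain k where k: "((*v) X ^^ k) w \<in> vec.span ((\<lambda>i. ((*v) X ^^ i) w) ` {..<k})"
    using sequence_dependent[of "\<lambda>i. ((*v) X ^^ i) w"] by blast
  have evmonom: "ev (monom 1 i) = ((*v) X ^^ i) w" for i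
    by (induction i) (simp_all add: monom_0 monom_Suc evC ev0)
  have span: "u \<in> vec.span ((\<lambda>i. ((*v) X ^^ i) w) ` {..<k}) \<Longrightarrow>
      \<exists>p. (p = 0 \<or> degree p < k) \<and> ev p = u" for u
  proof (induction rule: vec.span_induct_alt)
    case base
    then show ?case using ev0 by blast
  next
    case (step c x y)
    then obtain i p where i: "i < k" "x = ((*v) X ^^ i) w" and p: "p = 0 \<or> degree p < k" "ev p = y"
      by auto
    have "degree (smult c (monom 1 i) + p) < k"
      using i p by (intro degree_add_less) (auto simp: degree_monom_eq intro: le_less_trans[OF degree_smult_le])
    moreover have "ev (smult c (monom 1 i) + p) = c *s x + y"
      by (simp only: evadd evsmult evmonom i p)
    ultimately show ?case by blast
  qed
  obtain p where p: "p = 0 \<or> degree p < k" "ev p = ((*v) X ^^ k) w" using span[OF k] by blast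
  have "coeff (monom 1 k - p) k = 1" using p(1) by (auto simp: coeff_eq_0)
  hence "monom 1 k - p \<noteq> 0" by (metis coeff_0 zero_neq_one)
  moreover have "ev (monom 1 k - p) = 0"
    using evadd[of "monom 1 k - p" p] p(2) by (simp add: evmonom)
  ultimately have ex: "\<exists>n q. q \<noteq> 0 \<and> ev q = 0 \<and> degree q = n" by blast
  obtain n where n: "\<exists>q. q \<noteq> 0 \<and> ev q = 0 \<and> degree q = n"
    and least: "\<And>m. m < n \<Longrightarrow> \<nexists>q. q \<noteq> 0 \<and> ev q = 0 \<and> degree q = m"
    using exists_least_iff[THEN iffD1, OF ex] by blast
  then obtain q where q: "q \<noteq> 0" "ev q = 0" "degree q = n" by blast
  have "degree q \<noteq> 0"
  proof
    assume "degree q = 0"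
    then obtain a where "q = [:a:]" by (rule degree_eq_zeroE)
    with q w show False by (simp add: evC ev0)
  qed
  then obtain r where "poly q r = 0" using alg_closed_imp_poly_has_root[of q] by auto
  then obtain h where h: "q = [:-r, 1:] * h" by (metis dvdE poly_eq_0_iff_dvd)
  have hnz: "h \<noteq> 0" using q h by auto
  have "degree q = Suc (degree h)" unfolding h using hnz by (subst degree_mult_eq) auto
  hence "ev h \<noteq> 0" using least[of "degree h"] q hnz by auto
  moreover have "ev q = X *v ev h - r *s ev h"
    using evadd[of "smult (-r) h" "pCons 0 h"] evsmult[of "-r" h] by (simp add: h evC)
  ultimately show ?thesis using evW q by auto
qed

text \<open>The step of Lie's theorem that is usually done with traces. On the cyclic vectors \<open>e i = Y\<^sup>i v\<close> the
  relation \<open>N Y = Y N + Z\<close> gives \<open>N e\<^sub>i = i \<mu> e\<^sub>i\<^sub>-\<^sub>1\<close> modulo earlier vectors. If \<open>e\<^sub>k\<close> is the first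
  vector that depends on the preceding ones, then \<open>N e\<^sub>k\<close> lies in the span of \<open>e\<^sub>0, \<dots>, e\<^sub>k\<^sub>-\<^sub>2\<close>, which
  is impossible unless \<open>k \<mu> = 0\<close>.\<close>

lemma commutator_weight_zero:
  fixes N Y Z :: "complex^'n^'n"
  assumes NY: "N ** Y - Y ** N = Z" and v: "v \<noteq> 0" "N *v v = 0"
    and e: "\<And>i. e i = ((*v) Y ^^ i) v"
    and Z: "\<And>i. Z *v e i - \<mu> *s e i \<in> vec.span (e ` {..<i})"
  shows "\<mu> = 0"
proof -
  have mono: "i \<le> j \<Longrightarrow> vec.span (e ` {..<i}) \<subseteq> vec.span (e ` {..<j})" for i j
    by (intro vec.span_mono image_mono) auto
  have eS: "e (Suc i) = Y *v e i" for i by (simp add: e)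
  have YS: "Y *v u \<in> vec.span (e ` {..<Suc i})" if "u \<in> vec.span (e ` {..<i})" for u i
    using that
  proof (induction rule: vec.span_induct_alt)
    case (step c x y)
    then obtain j where "j < i" "x = e j" by auto
    hence "Y *v x \<in> vec.span (e ` {..<Suc i})" by (auto simp: eS[symmetric] intro!: vec.span_base)
    with step show ?case
      by (simp add: matrix_vector_right_distrib vector_scalar_commute vec.span_add vec.span_scale)
  qed (simp add: vec.span_zero)
  have NYc: "N *v (Y *v u) = Y *v (N *v u) + Z *v u" for u
    unfolding NY[symmetric] by (simp add: matrix_vector_mult_diff_rdistrib matrix_vector_mul_assoc)
  have Ne: "N *v e (Suc i) - of_nat (Suc i) *s (\<mu> *s e i) \<in> vec.span (e ` {..<i})" for i
  proof (induction i)
    case 0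
    show ?case using Z[of 0] v NYc[of v] by (simp add: e)
  next
    case (Suc i)
    have "N *v e (Suc (Suc i)) - of_nat (Suc (Suc i)) *s (\<mu> *s e (Suc i))
      = Y *v (N *v e (Suc i) - of_nat (Suc i) *s (\<mu> *s e i)) + (Z *v e (Suc i) - \<mu> *s e (Suc i))"
      unfolding eS[of "Suc i"] NYc
      by (simp add: vec_eq_iff matrix_vector_mult_diff_distrib vector_scalar_commute eS[of i] algebra_simps)
    also have "\<dots> \<in> vec.span (e ` {..<Suc i})"
      by (intro vec.span_add YS Suc Z)
    finally show ?case .
  qed
  have NS: "N *v u \<in> vec.span (e ` {..<m})" if "u \<in> vec.span (e ` {..<Suc m})" for u m
    using that
  proof (induction rule: vec.span_induct_alt)
    case (step c x y)
    then obtain j where j: "j < Suc m" "x = e j" by blast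
    have "N *v e j \<in> vec.span (e ` {..<m})"
    proof (cases j)
      case 0 thus ?thesis using v by (simp add: e vec.span_zero)
    next
      case (Suc i)
      have "N *v e j = (N *v e (Suc i) - of_nat (Suc i) *s (\<mu> *s e i)) + of_nat (Suc i) *s (\<mu> *s e i)"
        by (simp add: Suc)
      also have "\<dots> \<in> vec.span (e ` {..<m})"
        using j Suc subsetD[OF mono[of i m] Ne[of i]]
        by (intro vec.span_add vec.span_scale vec.span_base[of "e i"]) auto
      finally show ?thesis .
    qed
    with step j show ?case
      by (simp add: matrix_vector_right_distrib vector_scalar_commute vec.span_add vec.span_scale)
  qed (simp add: vec.span_zero)
  obtain k where k: "e k \<in> vec.span (e ` {..<k})" "\<And>j. j < k \<Longrightarrow> e j \<notin> vec.span (e ` {..<j})"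
    using sequence_dependent[of e] by blast
  have "k \<noteq> 0" using k(1) v by (cases k) (auto simp: e)
  then obtain m where m: "k = Suc m" using not0_implies_Suc by blast
  have "N *v e k \<in> vec.span (e ` {..<m})" using NS k m by blast
  hence "of_nat (Suc m) *s (\<mu> *s e m) \<in> vec.span (e ` {..<m})"
    using vec.span_diff[OF _ Ne[of m]] m by force
  hence "inverse (of_nat (Suc m) * \<mu>) *s (of_nat (Suc m) *s (\<mu> *s e m)) \<in> vec.span (e ` {..<m})"
    by (rule vec.span_scale)
  hence "(inverse (of_nat (Suc m) * \<mu>) * (of_nat (Suc m) * \<mu>)) *s e m \<in> vec.span (e ` {..<m})"
    by (simp only: vec.scale_scale mult.assoc)
  moreover have "of_nat (Suc m) \<noteq> (0::complex)" by (rule of_nat_neq_0)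
  hence "inverse (of_nat (Suc m) * \<mu>) * (of_nat (Suc m) * \<mu>) = 1" if "\<mu> \<noteq> 0"
    using that by (intro left_inverse) (simp del: of_nat_Suc)
  ultimately show ?thesis using k(2)[of m] m by (metis lessI vec.scale_one)
qed

text \<open>Lie's theorem, by induction on the length of the descending chain \<open>D\<close>. The weight space \<open>V\<close> of a common eigenvector of \<open>D 1\<close> is
  invariant under \<open>D 0\<close>, because the weight \<open>l\<close> vanishes on commutators. On a minimal nonzero
  \<open>D 0\<close>-invariant subspace of \<open>V\<close> the commutators of \<open>D 0\<close> then vanish as well, so that eigenspaces
  of its members are again invariant and each member is a scalar.\<close>

lemma lie_common_eigenvector:
  fixes D :: "nat \<Rightarrow> (complex^'n^'n) set"
  assumes "\<And>i X Y. X \<in> D i \<Longrightarrow> Y \<in> D i \<Longrightarrow> X ** Y - Y ** X \<in> D (Suc i)"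
    and "\<And>i. D (Suc i) \<subseteq> D i" and "\<And>X. X \<in> D N \<Longrightarrow> \<exists>c. X = mat c"
  shows "\<exists>v. v \<noteq> 0 \<and> (\<forall>X\<in>D 0. \<exists>c. X *v v = c *s v)"
  using assms
proof (induction N arbitrary: D)
  case 0
  have "mat c *v (axis undefined 1) = c *s (axis undefined 1 :: complex^'n)" for c
    by (rule mat_mult_vec)
  moreover have "(axis undefined 1 :: complex^'n) \<noteq> 0" by (simp add: axis_eq_0_iff)
  ultimately show ?case using 0(3) by metis
next
  case (Suc N)
  have "\<exists>v. v \<noteq> 0 \<and> (\<forall>X\<in>D (Suc 0). \<exists>c. X *v v = c *s v)"
    using Suc.prems by (intro Suc.IH[of "\<lambda>i. D (Suc i)"]) auto
  then obtain v where v: "v \<noteq> 0" "\<forall>X\<in>D (Suc 0). \<exists>c. X *v v = c *s v" by blast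
  then obtain l where l: "\<And>X. X \<in> D (Suc 0) \<Longrightarrow> X *v v = l X *s v" by metis
  define V where "V = {w. \<forall>X\<in>D (Suc 0). X *v w = l X *s w}"
  have V: "vec.subspace V"
    by (auto simp: V_def vec.subspace_def matrix_vector_right_distrib vector_scalar_commute vec.scale_right_distrib)
  have comm: "X ** Y - Y ** X \<in> D (Suc 0)" if "X \<in> D 0" "Y \<in> D 0" for X Y
    using that Suc.prems(1) by blast
  have cm: "X *v (Y *v u) = Y *v (X *v u) + (X ** Y - Y ** X) *v u" for X Y :: "complex^'n^'n" and u
    by (simp add: matrix_vector_mult_diff_rdistrib matrix_vector_mul_assoc)
  have invV: "Y *v w \<in> V" if Y: "Y \<in> D 0" and w: "w \<in> V" for Y w
  proof (cases "w = 0")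
    case False
    define e where "e i = ((*v) Y ^^ i) w" for i
    have eS: "e (Suc i) = Y *v e i" for i by (simp add: e_def)
    have YS: "Y *v u \<in> vec.span (e ` {..<Suc i})" if "u \<in> vec.span (e ` {..<i})" for u i
      using that
    proof (induction rule: vec.span_induct_alt)
      case (step c x y)
      then obtain j where "j < i" "x = e j" by auto
      hence "Y *v x \<in> vec.span (e ` {..<Suc i})" by (auto simp: eS[symmetric] intro!: vec.span_base)
      with step show ?case
        by (simp add: matrix_vector_right_distrib vector_scalar_commute vec.span_add vec.span_scale)
    qed (simp add: vec.span_zero)
    have tri: "\<forall>Z\<in>D (Suc 0). Z *v e i - l Z *s e i \<in> vec.span (e ` {..<i})" for i
    proof (induction i)
      case 0
      show ?case using w by (auto simp: V_def e_def vec.span_zero)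
    next
      case (Suc i)
      show ?case
      proof
        fix Z assume Z: "Z \<in> D (Suc 0)"
        let ?Z = "Z ** Y - Y ** Z"
        have Z': "?Z \<in> D (Suc 0)" using comm Y Z Suc.prems subsetD[OF \<open>\<And>i. D (Suc i) \<subseteq> D i\<close>[of 0]] by blast
        have eq: "Z *v e (Suc i) - l Z *s e (Suc i)
            = Y *v (Z *v e i - l Z *s e i) + ((?Z *v e i - l ?Z *s e i) + l ?Z *s e i)"
          unfolding eS cm[of Z Y]
          by (simp add: matrix_vector_mult_diff_distrib vector_scalar_commute)
        have "?Z *v e i - l ?Z *s e i \<in> vec.span (e ` {..<Suc i})"
          using Suc.IH Z' subsetD[OF vec.span_mono[of "e ` {..<i}" "e ` {..<Suc i}"]] by force
        thus "Z *v e (Suc i) - l Z *s e (Suc i) \<in> vec.span (e ` {..<Suc i})"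
          unfolding eq using Suc.IH Z
          by (intro vec.span_add YS vec.span_scale vec.span_base[of "e i"]) auto
      qed
    qed
    show ?thesis unfolding V_def
    proof safe
      fix X assume X: "X \<in> D (Suc 0)"
      let ?Z = "X ** Y - Y ** X"
      have Z': "?Z \<in> D (Suc 0)" using comm Y X subsetD[OF \<open>\<And>i. D (Suc i) \<subseteq> D i\<close>[of 0]] by blast
      have "(X - mat (l X)) ** Y - Y ** (X - mat (l X)) = ?Z"
        by (rule commutator_shift)
      moreover have "mat (l X) *v w = l X *s w"
        by (rule mat_mult_vec)
      hence "(X - mat (l X)) *v w = 0"
        using w X by (simp add: V_def matrix_vector_mult_diff_rdistrib)
      ultimately have "l ?Z = 0"
        using commutator_weight_zero[of "X - mat (l X)" Y ?Z w e "l ?Z"] False tri Z' e_def by blast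
      hence "?Z *v w = 0" using w Z' by (simp add: V_def)
      thus "X *v (Y *v w) = l X *s (Y *v w)"
        using w X by (simp add: cm[of X Y] V_def vector_scalar_commute)
    qed
  qed (simp add: vec.subspace_0[OF V])
  \<comment> \<open>A subspace of minimal dimension with this property carries only scalars.\<close>
  define good where "good W \<longleftrightarrow> vec.subspace W \<and> W \<subseteq> V \<and> (\<exists>w\<in>W. w \<noteq> 0) \<and> (\<forall>Y\<in>D 0. \<forall>w\<in>W. Y *v w \<in> W)" for W
  have "good V" using V v l invV by (auto simp: good_def V_def)
  hence ex: "\<exists>n W. good W \<and> vec.dim W = n" by blast
  obtain n where n: "\<exists>W. good W \<and> vec.dim W = n" "\<And>m. m < n \<Longrightarrow> \<nexists>W. good W \<and> vec.dim W = m"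
    using exists_least_iff[THEN iffD1, OF ex] by blast
  then obtain W where W: "good W" "vec.dim W = n" by blast
  have scalar: "\<exists>c. \<forall>w\<in>W. X *v w = c *s w" if X: "X \<in> D 0" for X
  proof -
    obtain w where "w \<in> W" "w \<noteq> 0" using W by (auto simp: good_def)
    then obtain u c where u: "u \<in> W" "u \<noteq> 0" "X *v u = c *s u"
      using eigenvector_in_invariant_subspace[of W w X] W X unfolding good_def by blast
    define W' where "W' = {w \<in> W. X *v w = c *s w}"
    have sub: "vec.subspace W" using W by (simp add: good_def)
    have W's: "vec.subspace W'" unfolding W'_def
      using sub by (auto simp: vec.subspace_def matrix_vector_right_distrib vector_scalar_commute vec.scale_right_distrib)
    have "Y *v w \<in> W'" if Y: "Y \<in> D 0" and w: "w \<in> W'" for Y w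
    proof (cases "w = 0")
      case False
      let ?Z = "X ** Y - Y ** X"
      define e where "e i = ((*v) Y ^^ i) w" for i
      have eW: "e i \<in> W" for i
        by (induction i) (use w W Y in \<open>auto simp: e_def W'_def good_def\<close>)
      have Z: "?Z \<in> D (Suc 0)" using comm X Y by blast
      have "?Z *v e i - l ?Z *s e i \<in> vec.span (e ` {..<i})" for i
        using eW[of i] W Z by (auto simp: good_def V_def vec.span_zero)
      moreover have "(X - mat c) ** Y - Y ** (X - mat c) = ?Z"
        by (rule commutator_shift)
      moreover have "mat c *v w = c *s w"
        by (rule mat_mult_vec)
      hence "(X - mat c) *v w = 0"
        using w by (simp add: W'_def matrix_vector_mult_diff_rdistrib)
      ultimately have "l ?Z = 0"
        using commutator_weight_zero[of "X - mat c" Y ?Z w e "l ?Z"] False e_def by blast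
      moreover have "w \<in> V" using w W by (auto simp: W'_def good_def)
      ultimately have "?Z *v w = 0" using Z by (simp add: V_def)
      thus ?thesis using w W Y by (auto simp: W'_def cm[of X Y] good_def vector_scalar_commute)
    qed (simp add: vec.subspace_0[OF W's])
    hence "good W'" using W u W's by (auto simp: good_def W'_def)
    hence "vec.dim W \<le> vec.dim W'" using n(2)[of "vec.dim W'"] W(2) not_le by blast
    hence "W' = W" using vec.subspace_dim_equal[OF W's sub] by (auto simp: W'_def)
    thus ?thesis by (auto simp: W'_def)
  qed
  obtain w where "w \<in> W" "w \<noteq> 0" using W by (auto simp: good_def)
  thus ?case using scalar by blast
qed

section \<open>Polynomials and hyperplanes\<close>

definition linear_form :: "complex^'n \<Rightarrow> complex^'n \<Rightarrow> complex" where
  "linear_form a z = (\<Sum>k\<in>UNIV. a $ k * z $ k)"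

lemma linear_form_add [simp]: "linear_form a (x + y) = linear_form a x + linear_form a y"
  by (simp add: linear_form_def algebra_simps sum.distrib)

lemma linear_form_diff [simp]: "linear_form a (x - y) = linear_form a x - linear_form a y"
  by (simp add: linear_form_def algebra_simps sum_subtractf)

lemma linear_form_scale [simp]: "linear_form a (c *s x) = c * linear_form a x"
  by (simp add: linear_form_def algebra_simps sum_distrib_left)

lemma linear_form_zero [simp]: "linear_form a 0 = 0"
  by (simp add: linear_form_def)

lemma linear_form_scale_left: "linear_form (c *s a) x = c * linear_form a x"
  by (simp add: linear_form_def algebra_simps sum_distrib_left)

lemma linear_form_axis [simp]: "linear_form a (axis k c) = a $ k * c"
  by (simp add: linear_form_def axis_def if_distrib cong: if_cong)

lemma one_form_eq_linear_form: "one_form A z = linear_form (A z)"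
  by (simp add: fun_eq_iff one_form_def linear_form_def)

lemma linear_form_eq_0_iff: "(\<forall>u. linear_form a u = 0) \<longleftrightarrow> a = 0"
proof
  assume "\<forall>u. linear_form a u = 0"
  hence "linear_form a (axis k 1) = 0" for k by blast
  thus "a = 0" by (simp add: vec_eq_iff)
qed (simp add: linear_form_def)

text \<open>Polynomial functions of degree strictly less than \<open>d\<close>. With the strict bound the zero function has
  its own level \<open>d = 0\<close> and division by a linear form lowers \<open>d\<close> by exactly one.\<close>

definition poly_below :: "nat \<Rightarrow> (complex^'a \<Rightarrow> complex) \<Rightarrow> bool" where
  "poly_below d f \<longleftrightarrow>
     (\<exists>c. \<forall>z. f z = (\<Sum>\<alpha> | (\<Sum>k\<in>UNIV. \<alpha> k) < d. c \<alpha> * monomial_fun \<alpha> z))"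

lemma finite_multidegrees: "finite {\<alpha> :: 'a::finite \<Rightarrow> nat. (\<Sum>k\<in>UNIV. \<alpha> k) < d}"
proof -
  have "\<alpha> k < d" if "(\<Sum>k\<in>UNIV. \<alpha> k) < d" for \<alpha> :: "'a \<Rightarrow> nat" and k
    using member_le_sum[of k UNIV \<alpha>] that by simp
  hence "{\<alpha> :: 'a \<Rightarrow> nat. (\<Sum>k\<in>UNIV. \<alpha> k) < d} \<subseteq>
      {\<alpha>. \<forall>k. (k \<in> UNIV \<longrightarrow> \<alpha> k \<in> {..<d}) \<and> (k \<notin> UNIV \<longrightarrow> \<alpha> k = 0)}"
    by auto
  thus ?thesis by (rule finite_subset) (intro finite_set_of_finite_funs; simp)
qed

lemma poly_fun_iff_poly_below: "poly_fun f \<longleftrightarrow> (\<exists>d. poly_below (Suc d) f)"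
  by (simp add: poly_fun_def poly_below_def less_Suc_eq_le)

lemma poly_below_0 [simp]: "poly_below d (\<lambda>z. 0)"
  unfolding poly_below_def by (intro exI[of _ "\<lambda>_. 0"]) simp

lemma poly_below_zero: "poly_below 0 f \<Longrightarrow> f z = 0"
  by (auto simp: poly_below_def)

lemma poly_below_add: "poly_below d f \<Longrightarrow> poly_below d g \<Longrightarrow> poly_below d (\<lambda>z. f z + g z)"
  unfolding poly_below_def
proof (elim exE)
  fix c c' assume "\<forall>z. f z = (\<Sum>\<alpha> | (\<Sum>k\<in>UNIV. \<alpha> k) < d. c \<alpha> * monomial_fun \<alpha> z)"
    "\<forall>z. g z = (\<Sum>\<alpha> | (\<Sum>k\<in>UNIV. \<alpha> k) < d. c' \<alpha> * monomial_fun \<alpha> z)"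
  thus "\<exists>c. \<forall>z. f z + g z = (\<Sum>\<alpha> | (\<Sum>k\<in>UNIV. \<alpha> k) < d. c \<alpha> * monomial_fun \<alpha> z)"
    by (intro exI[of _ "\<lambda>\<alpha>. c \<alpha> + c' \<alpha>"]) (simp add: algebra_simps sum.distrib)
qed

lemma poly_below_cmult: "poly_below d f \<Longrightarrow> poly_below d (\<lambda>z. c * f z)"
  unfolding poly_below_def
proof (elim exE)
  fix c' assume "\<forall>z. f z = (\<Sum>\<alpha> | (\<Sum>k\<in>UNIV. \<alpha> k) < d. c' \<alpha> * monomial_fun \<alpha> z)"
  thus "\<exists>c'. \<forall>z. c * f z = (\<Sum>\<alpha> | (\<Sum>k\<in>UNIV. \<alpha> k) < d. c' \<alpha> * monomial_fun \<alpha> z)"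
    by (intro exI[of _ "\<lambda>\<alpha>. c * c' \<alpha>"]) (simp add: algebra_simps sum_distrib_left)
qed

lemma poly_below_diff: "poly_below d f \<Longrightarrow> poly_below d g \<Longrightarrow> poly_below d (\<lambda>z. f z - g z)"
  using poly_below_add[of d f "\<lambda>z. -1 * g z"] poly_below_cmult[of d g "-1"] by simp

lemma poly_below_sum: "(\<And>i. i \<in> I \<Longrightarrow> poly_below d (f i)) \<Longrightarrow> poly_below d (\<lambda>z. \<Sum>i\<in>I. f i z)"
  by (induction I rule: infinite_finite_induct) (simp_all add: poly_below_add)

lemma poly_below_monomial: "(\<Sum>k\<in>UNIV. \<alpha> k) < d \<Longrightarrow> poly_below d (monomial_fun \<alpha>)"
  unfolding poly_below_def
proof (intro exI[of _ "\<lambda>\<beta>. of_bool (\<beta> = \<alpha>)"] allI)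
  fix z assume "(\<Sum>k\<in>UNIV. \<alpha> k) < d"
  moreover have "of_bool (\<beta> = \<alpha>) * monomial_fun \<beta> z = (if \<beta> = \<alpha> then monomial_fun \<alpha> z else 0)" for \<beta>
    by simp
  ultimately show "monomial_fun \<alpha> z = (\<Sum>\<beta> | (\<Sum>k\<in>UNIV. \<beta> k) < d. of_bool (\<beta> = \<alpha>) * monomial_fun \<beta> z)"
    by (simp only: sum.delta[OF finite_multidegrees]) simp
qed

lemma monomial_fun_Suc: "monomial_fun (\<alpha>(k := Suc (\<alpha> k))) z = z $ k * monomial_fun \<alpha> z"
proof -
  have "monomial_fun (\<alpha>(k := Suc (\<alpha> k))) z
      = z $ k ^ Suc (\<alpha> k) * (\<Prod>j\<in>UNIV - {k}. z $ j ^ (\<alpha>(k := Suc (\<alpha> k))) j)"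
    unfolding monomial_fun_def by (subst prod.remove[of _ k]) auto
  also have "(\<Prod>j\<in>UNIV - {k}. z $ j ^ (\<alpha>(k := Suc (\<alpha> k))) j) = (\<Prod>j\<in>UNIV - {k}. z $ j ^ \<alpha> j)"
    by (intro prod.cong) auto
  also have "z $ k ^ Suc (\<alpha> k) * \<dots> = z $ k * (z $ k ^ \<alpha> k * \<dots>)" by simp
  also have "z $ k ^ \<alpha> k * (\<Prod>j\<in>UNIV - {k}. z $ j ^ \<alpha> j) = monomial_fun \<alpha> z"
    unfolding monomial_fun_def by (subst prod.remove[of _ k]) auto
  finally show ?thesis .
qed

lemma sum_fun_upd_Suc: "(\<Sum>j\<in>UNIV. (\<alpha>(k := Suc (\<alpha> k))) j) = Suc (\<Sum>j\<in>UNIV. \<alpha> j)"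
  for \<alpha> :: "'a::finite \<Rightarrow> nat"
proof -
  have "(\<Sum>j\<in>UNIV. (\<alpha>(k := Suc (\<alpha> k))) j) = Suc (\<alpha> k) + (\<Sum>j\<in>UNIV - {k}. (\<alpha>(k := Suc (\<alpha> k))) j)"
    by (subst sum.remove[of _ k]) auto
  also have "(\<Sum>j\<in>UNIV - {k}. (\<alpha>(k := Suc (\<alpha> k))) j) = (\<Sum>j\<in>UNIV - {k}. \<alpha> j)"
    by (intro sum.cong) auto
  also have "Suc (\<alpha> k) + \<dots> = Suc (\<Sum>j\<in>UNIV. \<alpha> j)"
    by (simp add: sum.remove[of UNIV k \<alpha>])
  finally show ?thesis .
qed

lemma poly_below_coord_mult:
  assumes "poly_below d f"
  shows "poly_below (Suc d) (\<lambda>z. z $ k * f z)"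
proof -
  obtain c where c: "\<And>z. f z = (\<Sum>\<alpha> | (\<Sum>k\<in>UNIV. \<alpha> k) < d. c \<alpha> * monomial_fun \<alpha> z)"
    using assms by (auto simp: poly_below_def)
  have "(\<lambda>z. z $ k * f z) =
      (\<lambda>z. \<Sum>\<alpha> | (\<Sum>k\<in>UNIV. \<alpha> k) < d. c \<alpha> * monomial_fun (\<alpha>(k := Suc (\<alpha> k))) z)"
    by (simp add: fun_eq_iff c sum_distrib_left monomial_fun_Suc algebra_simps)
  moreover have "poly_below (Suc d) \<dots>"
    by (intro poly_below_sum poly_below_cmult poly_below_monomial) (simp add: sum_fun_upd_Suc del: fun_upd_apply)
  ultimately show ?thesis by simp
qed

lemma poly_below_linear_form_mult:
  assumes "poly_below d f"
  shows "poly_below (Suc d) (\<lambda>z. linear_form a z * f z)"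
proof -
  have "poly_below (Suc d) (\<lambda>z. \<Sum>k\<in>UNIV. a $ k * (z $ k * f z))"
    using assms by (intro poly_below_sum poly_below_cmult poly_below_coord_mult)
  thus ?thesis by (simp add: linear_form_def sum_distrib_right mult.assoc)
qed

lemma poly_below_Suc: "poly_below d f \<Longrightarrow> poly_below (Suc d) f"
  unfolding poly_below_def
proof (elim exE)
  fix c assume c: "\<forall>z. f z = (\<Sum>\<alpha> | (\<Sum>k\<in>UNIV. \<alpha> k) < d. c \<alpha> * monomial_fun \<alpha> z)"
  have "(\<Sum>\<alpha> | (\<Sum>k\<in>UNIV. \<alpha> k) < d. c \<alpha> * monomial_fun \<alpha> z)
     = (\<Sum>\<alpha> | (\<Sum>k\<in>UNIV. \<alpha> k) < Suc d. (if (\<Sum>k\<in>UNIV. \<alpha> k) < d then c \<alpha> else 0) * monomial_fun \<alpha> z)" for z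
    by (intro sum.mono_neutral_cong_left finite_multidegrees) auto
  thus "\<exists>c. \<forall>z. f z = (\<Sum>\<alpha> | (\<Sum>k\<in>UNIV. \<alpha> k) < Suc d. c \<alpha> * monomial_fun \<alpha> z)"
    using c by (intro exI[of _ "\<lambda>\<alpha>. if (\<Sum>k\<in>UNIV. \<alpha> k) < d then c \<alpha> else 0"]) simp
qed

text \<open>For \<open>a(e) = 1\<close> the map \<open>z \<mapsto> z - a(z) e\<close> is the projection onto \<open>ker a\<close> along \<open>e\<close>. Divisibility of
  the difference by \<open>a\<close> passes from a monomial to its product with a coordinate by the Leibniz
  rule for differences.\<close>

lemma monomial_linear_division:
  fixes \<alpha> :: "'a::finite \<Rightarrow> nat"
  assumes "(\<Sum>k\<in>UNIV. \<alpha> k) = n"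
  shows "\<exists>q. poly_below n q \<and>
    (\<forall>z. monomial_fun \<alpha> z - monomial_fun \<alpha> (z - linear_form a z *s e) = linear_form a z * q z)"
  using assms
proof (induction n arbitrary: \<alpha>)
  case 0
  hence "monomial_fun \<alpha> z = 1" for z by (simp add: monomial_fun_def)
  thus ?case by (intro exI[of _ "\<lambda>_. 0"]) simp
next
  case (Suc n)
  then obtain k where k: "\<alpha> k \<noteq> 0" by (metis (full_types) nat.distinct(1) sum.neutral)
  define \<beta> where "\<beta> = \<alpha>(k := \<alpha> k - 1)"
  have \<alpha>: "\<alpha> = \<beta>(k := Suc (\<beta> k))" using k by (auto simp: \<beta>_def)
  have "(\<Sum>k\<in>UNIV. \<beta> k) = n" using Suc.prems sum_fun_upd_Suc[of \<beta> k] \<alpha> by simp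
  then obtain q where q: "poly_below n q"
      "\<And>z. monomial_fun \<beta> z - monomial_fun \<beta> (z - linear_form a z *s e) = linear_form a z * q z"
    and \<beta>: "poly_below (Suc n) (monomial_fun \<beta>)"
    using Suc.IH[of \<beta>] poly_below_monomial[of \<beta> "Suc n"] by auto
  define q' where "q' z = z $ k * q z + e $ k * (monomial_fun \<beta> z - linear_form a z * q z)" for z
  have "poly_below (Suc n) q'"
    unfolding q'_def using q \<beta>
    by (intro poly_below_add poly_below_cmult poly_below_diff poly_below_coord_mult poly_below_linear_form_mult)
  moreover have "monomial_fun \<alpha> z - monomial_fun \<alpha> (z - linear_form a z *s e) = linear_form a z * q' z" for z
  proof -
    have *: "monomial_fun \<beta> (z - linear_form a z *s e) = monomial_fun \<beta> z - linear_form a z * q z"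
      using q(2)[of z] by (simp add: algebra_simps)
    show ?thesis unfolding \<alpha> monomial_fun_Suc * q'_def by (simp add: algebra_simps)
  qed
  ultimately show ?case by blast
qed

text \<open>The factor theorem for a linear form: on \<open>ker a\<close> the polynomial vanishes, hence it equals its
  own difference with its composition with the projection onto \<open>ker a\<close>.\<close>

lemma poly_linear_division:
  fixes p :: "complex^'a \<Rightarrow> complex"
  assumes p: "poly_below (Suc d) p" and e: "linear_form a e = 1"
    and van: "\<And>z. linear_form a z = 0 \<Longrightarrow> p z = 0"
  shows "\<exists>q. poly_below d q \<and> (\<forall>z. p z = linear_form a z * q z)"
proof -
  obtain c where c: "\<And>z. p z = (\<Sum>\<alpha> | (\<Sum>k\<in>UNIV. \<alpha> k) < Suc d. c \<alpha> * monomial_fun \<alpha> z)"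
    using p by (auto simp: poly_below_def)
  have "\<exists>q. poly_below d q \<and>
    (\<forall>z. monomial_fun \<alpha> z - monomial_fun \<alpha> (z - linear_form a z *s e) = linear_form a z * q z)"
    if "(\<Sum>k\<in>UNIV. \<alpha> k) < Suc d" for \<alpha> :: "'a \<Rightarrow> nat"
  proof -
    have "poly_below n q \<Longrightarrow> n \<le> d \<Longrightarrow> poly_below d q" for n and q :: "complex^'a \<Rightarrow> complex"
      by (rotate_tac, induction d rule: dec_induct) (auto intro: poly_below_Suc)
    thus ?thesis using monomial_linear_division[OF refl, of \<alpha> a e] that by (meson less_Suc_eq_le)
  qed
  then obtain q where q: "\<And>\<alpha>. (\<Sum>k\<in>UNIV. \<alpha> k) < Suc d \<Longrightarrow> poly_below d (q \<alpha>)"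
    "\<And>\<alpha> z. (\<Sum>k\<in>UNIV. \<alpha> k) < Suc d \<Longrightarrow>
      monomial_fun \<alpha> z - monomial_fun \<alpha> (z - linear_form a z *s e) = linear_form a z * q \<alpha> z"
    by metis
  define Q where "Q z = (\<Sum>\<alpha> | (\<Sum>k\<in>UNIV. \<alpha> k) < Suc d. c \<alpha> * q \<alpha> z)" for z
  have "poly_below d Q" unfolding Q_def
    by (intro poly_below_sum poly_below_cmult q) auto
  moreover have "p z = linear_form a z * Q z" for z
  proof -
    have "p (z - linear_form a z *s e) = 0" using e by (intro van) simp
    hence "p z = p z - p (z - linear_form a z *s e)" by simp
    also have "\<dots> = (\<Sum>\<alpha> | (\<Sum>k\<in>UNIV. \<alpha> k) < Suc d.
        c \<alpha> * (monomial_fun \<alpha> z - monomial_fun \<alpha> (z - linear_form a z *s e)))"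
      unfolding c by (simp add: sum_subtractf right_diff_distrib)
    also have "\<dots> = linear_form a z * Q z"
      unfolding Q_def sum_distrib_left by (intro sum.cong) (simp_all add: q)
    finally show ?thesis .
  qed
  ultimately show ?thesis by blast
qed

lemma poly_fun_on_line:
  assumes "poly_fun p"
  shows "\<exists>P. \<forall>t. p (x + t *s v) = poly P t"
proof -
  obtain d c where c: "\<And>z. p z = (\<Sum>\<alpha> | (\<Sum>k\<in>UNIV. \<alpha> k) \<le> d. c \<alpha> * monomial_fun \<alpha> z)"
    using assms by (auto simp: poly_fun_def)
  have "p (x + t *s v) = poly (\<Sum>\<alpha> | (\<Sum>k\<in>UNIV. \<alpha> k) \<le> d. smult (c \<alpha>) (\<Prod>k\<in>UNIV. [:x $ k, v $ k:] ^ \<alpha> k)) t" for t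
    unfolding c monomial_fun_def by (simp add: poly_sum poly_prod)
  thus ?thesis by blast
qed

lemma poly_below_linear_form: "poly_below 2 (linear_form a)"
proof -
  have "poly_below 1 (\<lambda>z. 1)"
    using poly_below_monomial[of "\<lambda>_. 0" 1] by (simp add: monomial_fun_def[abs_def])
  from poly_below_linear_form_mult[OF this, of a] show ?thesis by (simp add: numeral_2_eq_2)
qed

lemma poly_fun_linear_form: "poly_fun (linear_form a)"
  using poly_below_linear_form[of a] by (auto simp: poly_fun_iff_poly_below numeral_2_eq_2)

lemma algebraic_set_separate:
  assumes "algebraic_set S" "x \<notin> S"
  shows "\<exists>p. poly_fun p \<and> p x \<noteq> 0 \<and> (\<forall>z\<in>S. p z = 0)"
proof -
  obtain P where "\<forall>p\<in>P. poly_fun p" "S = {z. \<forall>p\<in>P. p z = 0}"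
    using assms(1) unfolding algebraic_set_def by blast
  thus ?thesis using assms(2) by auto
qed

text \<open>Two points witnessing a proper decomposition would give two polynomials whose product vanishes
  on the line through these points, while neither factor does.\<close>

lemma irreducible_linear_hyperplane: "irreducible_algebraic {z. linear_form a z = 0}"
  unfolding irreducible_algebraic_def
proof (intro conjI allI impI)
  show "algebraic_set {z. linear_form a z = 0}" unfolding algebraic_set_def
    by (intro exI[of _ "{linear_form a}"]) (auto intro: poly_fun_linear_form)
  show "{z. linear_form a z = 0} \<noteq> {}" using linear_form_zero[of a] by blast
  fix S1 S2 assume S: "algebraic_set S1 \<and> algebraic_set S2 \<and> {z. linear_form a z = 0} = S1 \<union> S2"
  show "{z. linear_form a z = 0} = S1 \<or> {z. linear_form a z = 0} = S2"
  proof (rule ccontr)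
    assume "\<not> ?thesis"
    with S obtain x y where xy: "x \<in> S2" "x \<notin> S1" "y \<in> S1" "y \<notin> S2" by blast
    obtain p where p: "poly_fun p" "p x \<noteq> 0" "\<And>z. z \<in> S1 \<Longrightarrow> p z = 0"
      using algebraic_set_separate[of S1 x] S xy by blast
    obtain q where q: "poly_fun q" "q y \<noteq> 0" "\<And>z. z \<in> S2 \<Longrightarrow> q z = 0"
      using algebraic_set_separate[of S2 y] S xy by blast
    obtain P where P: "\<And>t. p (x + t *s (y - x)) = poly P t"
      using poly_fun_on_line[OF p(1), of x "y - x"] by blast
    obtain Q where Q: "\<And>t. q (x + t *s (y - x)) = poly Q t"
      using poly_fun_on_line[OF q(1), of x "y - x"] by blast
    have "poly P t * poly Q t = 0" for t
    proof -
      have "x \<in> {z. linear_form a z = 0}" "y \<in> {z. linear_form a z = 0}" using S xy by auto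
      hence "x + t *s (y - x) \<in> {z. linear_form a z = 0}" by simp
      hence "x + t *s (y - x) \<in> S1 \<union> S2" using S by blast
      thus ?thesis using p(3) q(3) P Q by (metis Un_iff mult_zero_left mult_zero_right)
    qed
    hence "P * Q = 0" by (metis poly_0 poly_ext poly_mult)
    moreover have "poly P 0 \<noteq> 0" using P[of 0] p(2) by simp
    moreover have "poly Q 1 \<noteq> 0" using Q[of 1] q(2) by simp
    ultimately show False by auto
  qed
qed

text \<open>Hyperplanes have codimension one. Let \<open>p \<noteq> 0\<close> be of least degree among the polynomials vanishing
  on \<open>C\<close>. It is divisible by \<open>a\<close>, say \<open>p = a q\<close>, and \<open>C\<close> is the union of \<open>ker a\<close> and of the part of \<open>C\<close>
  where \<open>q\<close> vanishes. Irreducibility and \<open>C \<noteq> ker a\<close> force \<open>q\<close> to vanish on \<open>C\<close>, against the choice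
  of \<open>p\<close>.\<close>

lemma irreducible_above_hyperplane:
  fixes C :: "(complex^'a) set"
  assumes a: "a \<noteq> 0" and C: "irreducible_algebraic C" and sub: "{z. linear_form a z = 0} \<subset> C"
  shows "C = UNIV"
proof (rule ccontr)
  assume "C \<noteq> UNIV"
  obtain k where k: "a $ k \<noteq> 0" using a by (auto simp: vec_eq_iff)
  define e where "e = axis k (1 / a $ k)"
  have e: "linear_form a e = 1" using k by (simp add: e_def)
  define bad where "bad d \<longleftrightarrow> (\<exists>p. poly_below d p \<and> (\<exists>z. p z \<noteq> 0) \<and> (\<forall>z\<in>C. p z = 0))" for d
  have "algebraic_set C" using C by (simp add: irreducible_algebraic_def)
  then obtain p x where "poly_fun p" "p x \<noteq> 0" "\<forall>z\<in>C. p z = 0"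
    using \<open>C \<noteq> UNIV\<close> algebraic_set_separate by blast
  hence ex: "\<exists>d. bad d" unfolding bad_def poly_fun_iff_poly_below by blast
  obtain d where d: "bad d" "\<And>i. i < d \<Longrightarrow> \<not> bad i"
    using exists_least_iff[THEN iffD1, OF ex] by blast
  obtain p where p: "poly_below d p" "\<exists>z. p z \<noteq> 0" "\<And>z. z \<in> C \<Longrightarrow> p z = 0"
    using d(1) by (auto simp: bad_def)
  have "d \<noteq> 0" using p(1,2) poly_below_zero by metis
  then obtain d' where d': "d = Suc d'" using not0_implies_Suc by blast
  obtain q where q: "poly_below d' q" "\<And>z. p z = linear_form a z * q z"
    using poly_linear_division[of d' p a e] p e sub d' by blast
  have pfq: "poly_fun q" using poly_below_Suc[OF q(1)] by (auto simp: poly_fun_iff_poly_below)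
  obtain P where P: "\<forall>p\<in>P. poly_fun p" "C = {z. \<forall>p\<in>P. p z = 0}"
    using \<open>algebraic_set C\<close> by (auto simp: algebraic_set_def)
  let ?C1 = "{z. linear_form a z = 0}" and ?C2 = "{z \<in> C. q z = 0}"
  have "algebraic_set ?C2" unfolding algebraic_set_def
    by (rule exI[of _ "insert q P"]) (use P pfq in auto)
  moreover have "algebraic_set ?C1"
    using irreducible_linear_hyperplane[of a] unfolding irreducible_algebraic_def by blast
  moreover have "C = ?C1 \<union> ?C2" using sub p(3) q(2) by auto
  ultimately have "C = ?C1 \<or> C = ?C2" using C unfolding irreducible_algebraic_def by blast
  hence "\<forall>z\<in>C. q z = 0" using sub by blast
  moreover have "\<exists>z. q z \<noteq> 0" using p(2) q(2) by auto
  ultimately have "bad d'" using q(1) by (auto simp: bad_def)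
  thus False using d(2)[of d'] d' by simp
qed

lemma codim_two_hyperplane:
  fixes Z :: "(complex^'a) set"
  assumes "codim_ge 2 Z" and a: "a \<noteq> 0"
  shows "\<exists>z. linear_form a z = 0 \<and> z \<notin> Z"
proof (rule ccontr)
  assume "\<not> ?thesis"
  hence "{z. linear_form a z = 0} \<subseteq> Z" by blast
  then obtain C where C: "C 0 = {z. linear_form a z = 0}" "\<forall>i\<le>2. irreducible_algebraic (C i)"
    "\<forall>i<2. C i \<subset> C (Suc i)"
    using assms(1)[unfolded codim_ge_def, rule_format, OF conjI[OF irreducible_linear_hyperplane[of a]]]
    by metis
  have "C 1 = UNIV"
  proof (rule irreducible_above_hyperplane[OF a])
    show "irreducible_algebraic (C 1)" using C(2) by simp
    show "{z. linear_form a z = 0} \<subset> C 1" using C(3)[rule_format, of 0] by (simp add: C(1))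
  qed
  moreover have "C 1 \<subset> C (Suc 1)" using C(3) by simp
  ultimately show False by auto
qed

lemma homogeneous_poly_scale:
  assumes "homogeneous_poly d f"
  shows "f (c *s z) = c ^ d * f z"
proof -
  obtain b where b: "\<And>z. f z = (\<Sum>\<alpha> | (\<Sum>k\<in>UNIV. \<alpha> k) = d. b \<alpha> * monomial_fun \<alpha> z)"
    using assms by (auto simp: homogeneous_poly_def)
  have "monomial_fun \<alpha> (c *s z) = c ^ d * monomial_fun \<alpha> z" if "(\<Sum>k\<in>UNIV. \<alpha> k) = d" for \<alpha>
    using that by (simp add: monomial_fun_def power_mult_distrib prod.distrib power_sum[symmetric])
  thus ?thesis unfolding b sum_distrib_left by (intro sum.cong) (simp_all add: algebra_simps)
qed

lemma homogeneous_poly_imp_poly_fun: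
  assumes "homogeneous_poly d f"
  shows "poly_fun f"
proof -
  obtain b where b: "f = (\<lambda>z. \<Sum>\<alpha> | (\<Sum>k\<in>UNIV. \<alpha> k) = d. b \<alpha> * monomial_fun \<alpha> z)"
    using assms by (auto simp: homogeneous_poly_def)
  have "poly_below (Suc d) f" unfolding b
    by (intro poly_below_sum poly_below_cmult poly_below_monomial) auto
  thus ?thesis by (auto simp: poly_fun_iff_poly_below)
qed

lemma poly_fun_continuous: "poly_fun f \<Longrightarrow> continuous_on S f"
  unfolding poly_fun_def monomial_fun_def
  by (elim exE) (simp only: cong: continuous_on_cong, intro continuous_intros)

section \<open>Linear vector fields in the affine charts\<close>

lemma slot_inj [simp]: "slot k i = slot k j \<longleftrightarrow> i = j"
  by (cases k) (auto simp: slot_def split: if_splits)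

lemma slot_neq [simp]: "slot k i \<noteq> k" "k \<noteq> slot k i"
  by (auto simp: slot_def)

lemma slot_surj: "j \<noteq> k \<Longrightarrow> \<exists>i. slot k i = j"
  by (cases j; cases k) (auto simp: slot_def split: if_splits)

lemma slot_None [simp]: "slot None i = Some i"
  by (simp add: slot_def)

lemma slot_Some_self [simp]: "slot (Some l) l = None"
  by (simp add: slot_def)

lemma the_slot [simp]: "(THE i'. slot k i' = slot k i) = i"
  by (rule the_equality) auto

lemma vec_eq_slot_iff:
  fixes z w :: "complex^('m::finite) option"
  shows
  "z = w \<longleftrightarrow> z $ k = w $ k \<and> (\<forall>i. z $ slot k i = w $ slot k i)"
  by (metis slot_surj vec_eq_iff)

text \<open>The differential of \<open>hom_coord k\<close>, an affine map: it inserts the entry \<open>0\<close> at the place \<open>k\<close>.\<close>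

definition hom_dir :: "'m option \<Rightarrow> complex^'m \<Rightarrow> complex^('m::finite) option" where
  "hom_dir k v = (\<chi> j. if j = k then 0 else v $ (THE i. slot k i = j))"

lemma hom_coord_nth [simp]: "hom_coord k x $ k = 1" "hom_coord k x $ slot k i = x $ i"
  by (simp_all add: hom_coord_def)

lemma hom_dir_nth [simp]: "hom_dir k x $ k = 0" "hom_dir k x $ slot k i = x $ i"
  by (simp_all add: hom_dir_def)

lemma sum_option: "(\<Sum>s\<in>UNIV. f s) = f None + (\<Sum>j\<in>UNIV. f (Some j))"
  for f :: "'m::finite option \<Rightarrow> complex"
  by (simp add: UNIV_option_conv sum.reindex)

lemma hom_coord_None_Some [simp]: "hom_coord None x $ Some i = x $ i"
  using hom_coord_nth(2)[of None x i] by simp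

lemma hom_dir_None_Some [simp]: "hom_dir None x $ Some i = x $ i"
  using hom_dir_nth(2)[of None x i] by simp

lemma hom_coord_neq_0 [simp]: "hom_coord k x \<noteq> 0"
  by (metis hom_coord_nth(1) zero_index zero_neq_one)

lemma hom_coord_line: "hom_coord k (x + t *s v) = hom_coord k x + t *s hom_dir k v"
  by (simp add: vec_eq_slot_iff[where k = k])

lemma aff_hom [simp]: "aff_coord k (hom_coord k x) = x"
  by (simp add: aff_coord_def vec_eq_iff)

lemma aff_scale: "c \<noteq> 0 \<Longrightarrow> aff_coord k (c *s z) = aff_coord k z"
  by (simp add: aff_coord_def vec_eq_iff)

lemma hom_aff: "z $ k \<noteq> 0 \<Longrightarrow> hom_coord k (aff_coord k z) = (1 / z $ k) *s z"
  by (simp add: vec_eq_slot_iff[where k = k]) (simp add: aff_coord_def)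

lemma dir_deriv_hom_coord: "dir_deriv (hom_coord k) x v = hom_dir k v"
proof -
  have "deriv (\<lambda>t. hom_coord k (x + t *s v) $ j) 0 = hom_dir k v $ j" for j
    by (intro DERIV_imp_deriv) (auto simp: hom_coord_line intro!: derivative_eq_intros)
  thus ?thesis by (simp add: dir_deriv_def vec_eq_iff)
qed

lemma dir_deriv_aff_coord:
  assumes "(M *v hom_coord k x) $ l \<noteq> 0"
  shows "dir_deriv (\<lambda>y. aff_coord l (M *v hom_coord k y)) x v =
    (\<chi> i. ((M *v hom_dir k v) $ slot l i * (M *v hom_coord k x) $ l
           - (M *v hom_coord k x) $ slot l i * (M *v hom_dir k v) $ l)
          / ((M *v hom_coord k x) $ l)\<^sup>2)"
proof -
  have "deriv (\<lambda>t. aff_coord l (M *v hom_coord k (x + t *s v)) $ i) 0 =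
      ((M *v hom_dir k v) $ slot l i * (M *v hom_coord k x) $ l
           - (M *v hom_coord k x) $ slot l i * (M *v hom_dir k v) $ l)
          / ((M *v hom_coord k x) $ l)\<^sup>2" for i
    using assms
    by (intro DERIV_imp_deriv)
      (auto simp: aff_coord_def hom_coord_line matrix_vector_right_distrib vector_scalar_commute
        power2_eq_square intro!: derivative_eq_intros)
  thus ?thesis by (simp add: dir_deriv_def vec_eq_iff)
qed

text \<open>The field induced on projective space by \<open>z \<mapsto> B z\<close>: in the chart \<open>k\<close> the multiple of the radial field
  that makes the coordinate \<open>z\<^sub>k\<close> constant is subtracted.\<close>

definition linear_field :: "complex^('m::finite) option^'m option \<Rightarrow> 'm chart_field" where
  "linear_field B k x =
     (\<chi> i. (B *v hom_coord k x) $ slot k i - x $ i * (B *v hom_coord k x) $ k)"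

lemma hom_dir_linear_field:
  "hom_dir k (linear_field B k x) =
     B *v hom_coord k x - (B *v hom_coord k x) $ k *s hom_coord k x"
  by (simp add: vec_eq_slot_iff[where k = k]) (simp add: linear_field_def)

text \<open>The right hand side is the differential of \<open>aff_coord l\<close> at \<open>w\<close> applied to \<open>u\<close>. It does not see
  multiples of \<open>w\<close>, and so the expressions in any two charts are compatible.\<close>

lemma linear_field_aff_coord:
  fixes w :: "complex^('m::finite) option"
  assumes "w $ l \<noteq> 0" "u = B *v w - c *s w"
  shows "linear_field B l (aff_coord l w) = (\<chi> i. (u $ slot l i * w $ l - w $ slot l i * u $ l) / (w $ l)\<^sup>2)"
proof -
  have "linear_field B l (aff_coord l w) $ i =
      (1 / w $ l) * (B *v w) $ slot l i - (w $ slot l i / w $ l) * ((1 / w $ l) * (B *v w) $ l)" for i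
    using assms(1) unfolding linear_field_def hom_aff[OF assms(1)]
    by (simp add: vector_scalar_commute) (simp add: aff_coord_def)
  moreover have "1 / d * p - s / d * (1 / d * q) = ((p - c * s) * d - s * (q - c * d)) / d\<^sup>2"
    if "d \<noteq> 0" for d p q s :: complex
    using that by (simp add: field_simps power2_eq_square)
  ultimately show ?thesis using assms(1) by (simp add: vec_eq_iff assms(2))
qed

lemma dir_deriv_linear_field:
  "dir_deriv (linear_field C k) x v =
    (\<chi> i. (C *v hom_dir k v) $ slot k i - v $ i * (C *v hom_coord k x) $ k
          - x $ i * (C *v hom_dir k v) $ k)"
proof -
  have "deriv (\<lambda>t. linear_field C k (x + t *s v) $ i) 0 =
      (C *v hom_dir k v) $ slot k i - v $ i * (C *v hom_coord k x) $ k
          - x $ i * (C *v hom_dir k v) $ k" for i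
    by (intro DERIV_imp_deriv)
      (auto simp: linear_field_def hom_coord_line matrix_vector_right_distrib vector_scalar_commute
        algebra_simps intro!: derivative_eq_intros)
  thus ?thesis by (simp add: dir_deriv_def vec_eq_iff)
qed

lemma vf_bracket_linear_field:
  "vf_bracket (linear_field B) (linear_field C) = linear_field (C ** B - B ** C)"
  by (simp add: fun_eq_iff vec_eq_iff vf_bracket_def dir_deriv_linear_field hom_dir_linear_field
      matrix_vector_mult_diff_distrib vector_scalar_commute)
    (simp add: linear_field_def matrix_vector_mult_diff_rdistrib matrix_vector_mul_assoc[symmetric]
      algebra_simps)

lemma matrix_axis: "(B *v axis j 1) $ r = B $ r $ j" for B :: "complex^'n^'m"
  by (simp add: matrix_vector_mult_def axis_def if_distrib cong: if_cong)

text \<open>If all the fields vanish then every \<open>B z\<close> is proportional to \<open>z\<close>. Points on the coordinate axes show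
  that \<open>B\<close> is diagonal, and sums of two axis vectors that the diagonal is constant.\<close>

lemma linear_field_eq_0:
  assumes "linear_field B = 0"
  shows "\<exists>c. B = mat c"
proof -
  have lf: "linear_field B k x $ i = 0" for k x i using assms by simp
  have off: "B $ r $ j = 0" if rj: "r \<noteq> j" for r j
  proof -
    obtain i where i: "slot j i = r" using slot_surj[OF rj] by blast
    have "hom_coord j 0 = axis j 1" by (simp add: vec_eq_slot_iff[where k = j] axis_def)
    thus ?thesis using lf[of j 0 i] i by (simp add: linear_field_def matrix_axis)
  qed
  have diag: "B $ j $ j = B $ None $ None" for j
  proof (cases "j = None")
    case False
    then obtain i where i: "slot None i = j" using slot_surj by blast
    have "hom_coord None (axis i 1) = axis None 1 + axis j 1"
      using i by (simp add: vec_eq_slot_iff[where k = None]) (auto simp: axis_def)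
    thus ?thesis using lf[of None "axis i 1" i] i off[of j None] off[of None j] False
      by (simp add: linear_field_def matrix_vector_right_distrib matrix_axis)
  qed simp
  have "B $ r $ j = mat (B $ None $ None) $ r $ j" for r j
    using off[of r j] diag[of j] by (simp add: mat_def)
  thus ?thesis by (metis vec_eq_iff)
qed

lemma bounded_linear_scale_vec: "bounded_linear (\<lambda>h::complex. h *s (v :: complex^'n))"
  unfolding linear_conv_bounded_linear[symmetric]
  by (rule linearI) (simp_all add: vec_eq_iff algebra_simps)

lemma continuous_on_scale_vec [continuous_intros]:
  fixes g :: "'a::topological_space \<Rightarrow> complex^'n"
  assumes "continuous_on S f" "continuous_on S g"
  shows "continuous_on S (\<lambda>t. f t *s g t)"
  unfolding vector_scalar_mult_def
  by (intro continuous_on_vec_lambda continuous_on_mult assms continuous_on_component)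

lemma scaleR_vec: "r *\<^sub>R (x :: complex^'n) = complex_of_real r *s x"
  by (simp add: vec_eq_iff scaleR_conv_of_real[where 'a = complex])

text \<open>Used to read off the value of a continuous expression at the point at infinity of a line.\<close>

lemma continuous_punctured_const:
  fixes f :: "complex \<Rightarrow> 'b::t2_space"
  assumes "continuous_on UNIV f" "\<And>s. s \<noteq> 0 \<Longrightarrow> f s = c"
  shows "f 0 = c"
proof -
  have "(f \<longlongrightarrow> f 0) (at 0)" using assms(1) by (simp add: continuous_on_def)
  moreover have "(f \<longlongrightarrow> c) (at 0)"
    by (rule tendsto_eventually) (auto simp: eventually_at_filter assms(2))
  ultimately show ?thesis by (rule tendsto_unique[rotated]) simp
qed

lemma scale_vec_functional:
  fixes g :: "complex^'n \<Rightarrow> complex"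
  assumes "\<And>x y. g (x + y) = g x + g y" "\<And>c x. g (c *s x) = c * g x"
  shows "g x = linear_form (\<chi> j. g (axis j 1)) x"
proof -
  have "g 0 = 0" using assms(2)[of 0] by simp
  hence "g (\<Sum>j\<in>S. f j) = (\<Sum>j\<in>S. g (f j))" for f and S :: "'n set"
    by (induction S rule: infinite_finite_induct) (simp_all add: assms(1))
  from this[of "\<lambda>j. x $ j *s axis j 1" UNIV] show ?thesis
    by (simp add: basis_expansion linear_form_def assms(2) mult.commute)
qed

section \<open>Every global vector field is linear\<close>

lemma entire_map_continuous: "entire_map f \<Longrightarrow> continuous_on S f"
  unfolding entire_map_def by (meson continuous_at_imp_continuous_on has_derivative_continuous)

lemma entire_map_line_deriv:
  fixes f :: "complex^'n \<Rightarrow> complex^'p"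
  assumes "(f has_derivative D) (at (p + t *s v))" "Vector_Spaces.linear (*s) (*s) D"
  shows "((\<lambda>t. f (p + t *s v) $ i) has_field_derivative D v $ i) (at t)"
proof -
  have "((\<lambda>t. p + t *s v) has_derivative (\<lambda>h. h *s v)) (at t)"
    using has_derivative_add[OF has_derivative_const[of p]
        bounded_linear_imp_has_derivative[OF bounded_linear_scale_vec[of v], of "at t"]] by simp
  hence "((\<lambda>t. f (p + t *s v)) has_derivative (\<lambda>h. D (h *s v))) (at t)"
    using assms(1) by (rule has_derivative_compose)
  hence "((\<lambda>t. f (p + t *s v) $ i) has_derivative (\<lambda>h. D (h *s v) $ i)) (at t)"
    by (rule bounded_linear.has_derivative[OF bounded_linear_vec_nth])
  moreover have "D (h *s v) $ i = D v $ i * h" for h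
    using vec.linear_scale[OF assms(2), of h v] by (simp add: mult.commute)
  ultimately show ?thesis by (simp add: has_field_derivative_def)
qed

lemma norm_vec_le_card: "(\<And>i. norm (y $ i) \<le> 1) \<Longrightarrow> norm (y :: complex^'n) \<le> real CARD('n)"
proof -
  assume "\<And>i. norm (y $ i) \<le> 1"
  hence "(\<Sum>i\<in>UNIV. norm (y $ i)) \<le> (\<Sum>i\<in>(UNIV::'n set). 1)" by (intro sum_mono)
  moreover have "norm y \<le> (\<Sum>i\<in>UNIV. norm (y $ i))"
    unfolding norm_vec_def by (rule L2_set_le_sum) simp
  ultimately show ?thesis by simp
qed

lemma holo_vector_fields_entire: "X \<in> holo_vector_fields \<Longrightarrow> entire_map (X k)"
  by (simp add: holo_vector_fields_def)

lemma holo_vector_fields_change: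
  assumes "X \<in> holo_vector_fields" "hom_coord k x $ l \<noteq> 0"
  shows "X l (aff_coord l (hom_coord k x)) $ i =
    (hom_dir k (X k x) $ slot l i * hom_coord k x $ l
       - hom_coord k x $ slot l i * hom_dir k (X k x) $ l) / (hom_coord k x $ l)\<^sup>2"
proof -
  have "X l (aff_coord l (hom_coord k x)) = dir_deriv (\<lambda>y. aff_coord l (hom_coord k y)) x (X k x)"
    using assms by (simp add: holo_vector_fields_def)
  thus ?thesis using dir_deriv_aff_coord[of "mat 1" k x l "X k x"] assms(2) by simp
qed

text \<open>Every point lies in the closed unit polydisc of the chart belonging to its largest homogeneous
  coordinate, where the field is bounded by compactness. Transporting the bound to the
  standard chart costs a factor quadratic in the coordinates.\<close>

lemma holo_vector_fields_growth:
  fixes X :: "('m::finite) chart_field"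
  assumes X: "X \<in> holo_vector_fields"
  shows "\<exists>K. \<forall>x i. norm (X None x $ i) \<le> K * (1 + (norm x)\<^sup>2)"
proof -
  have "\<exists>K. \<forall>y. (\<forall>i. norm (y $ i) \<le> 1) \<longrightarrow> norm (X k y) \<le> K" for k
  proof -
    have "compact (X k ` cball 0 (real CARD('m)))"
      using X by (intro compact_continuous_image entire_map_continuous holo_vector_fields_entire) auto
    then obtain K where K: "\<And>y. norm y \<le> real CARD('m) \<Longrightarrow> norm (X k y) \<le> K"
      using compact_imp_bounded bounded_iff by (metis (no_types, lifting) image_eqI mem_cball_0)
    have "norm (X k y) \<le> K" if "\<forall>i. norm (y $ i) \<le> 1" for y
      using norm_vec_le_card[of y] that by (intro K) blast
    thus ?thesis by blast
  qed
  then obtain K' where K': "\<And>k y. (\<forall>i. norm (y $ i) \<le> 1) \<Longrightarrow> norm (X k y) \<le> K' k" by metis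
  define K where "K = (\<Sum>k\<in>UNIV. \<bar>K' k\<bar>)"
  have K: "norm (X k y $ i) \<le> K" if "\<forall>i. norm (y $ i) \<le> 1" for k y i
  proof -
    have "norm (X k y $ i) \<le> norm (X k y)" by (rule Finite_Cartesian_Product.norm_nth_le)
    also have "\<dots> \<le> \<bar>K' k\<bar>" using K'[OF that, of k] by linarith
    also have "\<dots> \<le> K" unfolding K_def by (rule member_le_sum) auto
    finally show ?thesis .
  qed
  have K0: "0 \<le> K" by (simp add: K_def sum_nonneg)
  have "norm (X None x $ i) \<le> 2 * K * (1 + (norm x)\<^sup>2)" for x i
  proof (cases "\<forall>i. norm (x $ i) \<le> 1")
    case True
    have "norm (X None x $ i) \<le> K * 1" using K[OF True] by simp
    also have "\<dots> \<le> K * (2 * (1 + (norm x)\<^sup>2))" using K0 by (intro mult_left_mono) auto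
    finally show ?thesis by (simp add: mult_ac)
  next
    case False
    then obtain j where j: "norm (x $ j) > 1" by (auto simp: not_le)
    obtain l where l: "\<And>i. norm (x $ i) \<le> norm (x $ l)"
    proof -
      have "Max (range (\<lambda>i. norm (x $ i))) \<in> range (\<lambda>i. norm (x $ i))" by (intro Max_in) auto
      then obtain l where "Max (range (\<lambda>i. norm (x $ i))) = norm (x $ l)" by (rule rangeE)
      thus thesis using that Max_ge[of "range (\<lambda>i. norm (x $ i))"] by (metis finite finite_imageI rangeI)
    qed
    have l1: "norm (x $ l) > 1" using l[of j] j by linarith
    hence l0: "0 < norm (x $ l)" "x $ l \<noteq> 0" by auto
    define y where "y = aff_coord (Some l) (hom_coord None x)"
    have nz: "hom_coord None x $ Some l \<noteq> 0" using l1 by auto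
    have y: "y $ i' = (if i' = l then 1 / x $ l else x $ i' / x $ l)" for i'
      by (auto simp: y_def aff_coord_def slot_def hom_coord_def)
    have y1: "\<forall>i. norm (y $ i) \<le> 1" using l0 l1 l by (simp add: y norm_divide divide_le_eq_1_pos)
    have xl2: "(norm (x $ l))\<^sup>2 \<le> (norm x)\<^sup>2"
      by (intro power_mono Finite_Cartesian_Product.norm_nth_le) auto
    have Xl: "X (Some l) y $ l = - X None x $ l / (x $ l)\<^sup>2"
      unfolding y_def holo_vector_fields_change[OF X nz] by (simp add: hom_coord_def hom_dir_def)
    hence Xl': "X None x $ l = - (X (Some l) y $ l) * (x $ l)\<^sup>2" using l1 by auto
    have nl: "norm (X None x $ l) \<le> K * (norm (x $ l))\<^sup>2"
      unfolding Xl' norm_mult norm_power norm_minus_cancel by (intro mult_right_mono K y1) auto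
    have solve: "F = d * b + s / d * G" if "b = (F * d - s * G) / d\<^sup>2" "d \<noteq> 0" for b d s F G :: complex
      using that by (simp add: field_simps power2_eq_square)
    have "norm (X None x $ i) \<le> 2 * K * (norm (x $ l))\<^sup>2"
    proof (cases "i = l")
      case True
      thus ?thesis using nl mult_nonneg_nonneg[OF K0 zero_le_power2[of "norm (x $ l)"]] by (simp add: mult.assoc)
    next
      case False
      have "X (Some l) y $ i = (X None x $ i * x $ l - x $ i * X None x $ l) / (x $ l)\<^sup>2"
        unfolding y_def holo_vector_fields_change[OF X nz] using False by (simp add: slot_def)
      hence "X None x $ i = x $ l * X (Some l) y $ i + x $ i / x $ l * X None x $ l"
        using l0(2) by (rule solve)
      hence "norm (X None x $ i) \<le> norm (x $ l) * norm (X (Some l) y $ i)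
          + norm (x $ i / x $ l) * norm (X None x $ l)"
        by (metis norm_mult norm_triangle_ineq)
      also have "\<dots> \<le> (norm (x $ l))\<^sup>2 * K + 1 * (K * (norm (x $ l))\<^sup>2)"
      proof (intro add_mono mult_mono nl K y1)
        show "norm (x $ l) \<le> (norm (x $ l))\<^sup>2" using l1 by (intro self_le_power) auto
        show "norm (x $ i / x $ l) \<le> 1" using l[of i] l0 by (simp add: norm_divide divide_le_eq_1_pos)
      qed auto
      finally show ?thesis by (simp add: mult_ac)
    qed
    also have "\<dots> \<le> 2 * K * (1 + (norm x)\<^sup>2)" using K0 order_trans[OF xl2, of "1 + (norm x)\<^sup>2"] by (intro mult_left_mono) auto
    finally show ?thesis .
  qed
  thus ?thesis by blast
qed

text \<open>Liouville's theorem, applied on each complex line, turns the quadratic growth into a polynomial of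
  degree at most two.\<close>

lemma holo_vector_fields_quadratic_on_lines:
  fixes X :: "('m::finite) chart_field"
  assumes X: "X \<in> holo_vector_fields"
  shows "\<exists>D Q. (\<forall>p. Vector_Spaces.linear (*s) (*s) (D p)) \<and>
    (\<forall>p v t. X None (p + t *s v) = X None p + t *s D p v + t\<^sup>2 *s Q p v)"
proof -
  have "\<forall>p. \<exists>D. Vector_Spaces.linear (*s) (*s) D \<and> (X None has_derivative D) (at p)"
    using holo_vector_fields_entire[OF X, of None] by (simp add: entire_map_def)
  then obtain D where D: "\<And>p. Vector_Spaces.linear (*s) (*s) (D p)"
      "\<And>p. (X None has_derivative D p) (at p)" by metis
  obtain K where K: "\<And>x i. norm (X None x $ i) \<le> K * (1 + (norm x)\<^sup>2)"
    using holo_vector_fields_growth[OF X] by blast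
  have K0: "0 \<le> K" using order_trans[OF norm_ge_zero K[of 0 undefined]] by simp
  have "\<exists>q. \<forall>t. X None (p + t *s v) $ i = X None p $ i + t * D p v $ i + t\<^sup>2 * q" for p v i
  proof -
    define f where "f t = X None (p + t *s v) $ i" for t
    have f': "(f has_field_derivative D (p + t *s v) v $ i) (at t)" for t
      unfolding f_def[abs_def] by (rule entire_map_line_deriv[OF D(2,1)])
    have "f holomorphic_on UNIV" using f' by (auto simp: holomorphic_on_open)
    define R where "R = norm p + norm v"
    have "norm (f t) \<le> K * (1 + R\<^sup>2) * norm t ^ 2" if t: "1 \<le> norm t" for t
    proof -
      have "norm (t *s v) = norm t * norm v"
        by (simp add: norm_vec_def norm_mult L2_set_right_distrib)
      hence "norm (p + t *s v) \<le> norm p * norm t + norm t * norm v"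
        using norm_triangle_ineq[of p "t *s v"] mult_left_mono[OF t norm_ge_zero[of p]] by linarith
      hence "norm (p + t *s v) \<le> R * norm t" by (simp add: R_def algebra_simps)
      hence "(norm (p + t *s v))\<^sup>2 \<le> (R * norm t)\<^sup>2" by (intro power_mono) auto
      moreover have "1 \<le> norm t ^ 2" using t by (simp add: one_le_power)
      ultimately have "1 + (norm (p + t *s v))\<^sup>2 \<le> (1 + R\<^sup>2) * norm t ^ 2"
        by (simp add: algebra_simps power_mult_distrib)
      hence "K * (1 + (norm (p + t *s v))\<^sup>2) \<le> K * ((1 + R\<^sup>2) * norm t ^ 2)"
        using K0 by (rule mult_left_mono)
      thus ?thesis using K[of "p + t *s v" i] by (simp add: f_def mult.assoc)
    qed
    hence expand: "f t = (\<Sum>k\<le>2. (deriv ^^ k) f 0 / fact k * t ^ k)" for t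
      using \<open>f holomorphic_on UNIV\<close> by (intro Liouville_polynomial[of f 1 "K * (1 + R\<^sup>2)" 2]) auto
    have three: "(\<Sum>k\<le>2. h k) = h 0 + h 1 + h 2" for h :: "nat \<Rightarrow> complex"
      by (simp add: numeral_2_eq_2)
    have "deriv f 0 = D p v $ i" using f'[of 0] by (simp add: DERIV_imp_deriv)
    hence "f t = f 0 + t * D p v $ i + t\<^sup>2 * ((deriv ^^ 2) f 0 / fact 2)" for t
      using trans[OF expand[of t] three] by simp
    hence "\<exists>q. \<forall>t. f t = f 0 + t * D p v $ i + t\<^sup>2 * q" by blast
    thus ?thesis by (simp add: f_def)
  qed
  then obtain q where "\<And>p v i t. X None (p + t *s v) $ i = X None p $ i + t * D p v $ i + t\<^sup>2 * q p v i"
    by metis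
  hence "X None (p + t *s v) = X None p + t *s D p v + t\<^sup>2 *s (\<chi> i. q p v i)" for p v t
    by (simp add: vec_eq_iff)
  thus ?thesis using D(1) by (intro exI[of _ D] exI[of _ "\<lambda>p v. \<chi> i. q p v i"]) blast
qed

text \<open>The expression \<open>F\<close> of the field in the standard chart is \<open>F 0 + D 0 v + q v\<close> with \<open>q\<close> homogeneous of
  degree two. Comparing the leading terms on parallel lines shows that the second-order coefficient
  does not depend on the base point, hence that \<open>q\<close> is a quadratic map. Holomorphy at infinity, in
  the chart \<open>l\<close>, gives \<open>v\<^sub>l q\<^sub>i(v) = v\<^sub>i q\<^sub>l(v)\<close>; therefore \<open>q\<^sub>i(v) = v\<^sub>i g(v)\<close> with one linear form \<open>g\<close> for
  all \<open>i\<close>, which is exactly the quadratic part of a linear field.\<close>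

lemma holo_vector_fields_chart_None:
  fixes X :: "('m::finite) chart_field"
  assumes X: "X \<in> holo_vector_fields"
  shows "\<exists>B. X None = linear_field B None"
proof -
  obtain D Q where D: "\<And>p. Vector_Spaces.linear (*s) (*s) (D p)"
    and Q: "\<And>p v t. X None (p + t *s v) = X None p + t *s D p v + t\<^sup>2 *s Q p v"
    using holo_vector_fields_quadratic_on_lines[OF X] by blast
  define F where "F = X None"
  have Q: "F (p + t *s v) = F p + t *s D p v + t\<^sup>2 *s Q p v" for p v t
    using Q by (simp add: F_def)
  have contF: "continuous_on S F" for S
    unfolding F_def using X by (intro entire_map_continuous holo_vector_fields_entire)
  note Dadd = vec.linear_add[OF D] and Dscale = vec.linear_scale[OF D]
  have contD: "continuous_on S (D p)" for S p
    using linear_continuous_on[OF linear_conv_bounded_linear[THEN iffD1, OF linearI], of "D p"]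
    by (simp add: Dadd Dscale scaleR_vec)
  define q where "q v = F v - F 0 - D 0 v" for v
  have contq: "continuous_on S q" for S
    unfolding q_def by (intro continuous_intros contF contD)
  have q0: "q v = Q 0 v" for v using Q[of 0 1 v] by (simp add: q_def)
  have F_q: "F v = F 0 + D 0 v + q v" for v by (simp add: q_def)
  have qscale: "q (t *s v) = t\<^sup>2 *s q v" for t v
    using Q[of 0 t v] by (simp add: F_q[of "t *s v"] Dscale q0[of v])
  have qQ: "q v = Q p v" for p v
  proof -
    \<comment> \<open>Up to the factor \<open>s\<^sup>2\<close> this compares the values at the point \<open>p + v / s\<close>, expanded from \<open>p\<close> and from \<open>0\<close>.\<close>
    define f where "f s = s\<^sup>2 *s F 0 + s *s D 0 (s *s p + v) + q (s *s p + v) - s\<^sup>2 *s F p - s *s D p v" for s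
    have "continuous_on UNIV f" unfolding f_def
      by (intro continuous_intros continuous_on_compose2[OF contq[of UNIV]] continuous_on_compose2[OF contD[of UNIV]]) auto
    moreover have "f s = Q p v" if "s \<noteq> 0" for s
    proof -
      have "p + (1 / s) *s v = (1 / s) *s (s *s p + v)"
        using that by (simp add: vec_eq_iff field_simps)
      hence "F 0 + (1 / s) *s D 0 (s *s p + v) + (1 / s)\<^sup>2 *s q (s *s p + v)
          = F p + (1 / s) *s D p v + (1 / s)\<^sup>2 *s Q p v"
        using Q[of p "1 / s" v] F_q[of "(1 / s) *s (s *s p + v)"] by (simp only: Dscale qscale)
      hence "s\<^sup>2 *s (F 0 + (1 / s) *s D 0 (s *s p + v) + (1 / s)\<^sup>2 *s q (s *s p + v))
          = s\<^sup>2 *s (F p + (1 / s) *s D p v + (1 / s)\<^sup>2 *s Q p v)" by simp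
      thus ?thesis using that by (simp add: f_def vec_eq_iff field_simps power2_eq_square)
    qed
    ultimately have "f 0 = Q p v" by (rule continuous_punctured_const)
    thus ?thesis by (simp add: f_def)
  qed
  \<comment> \<open>The polarisation of \<open>q\<close>: linear in \<open>v\<close> because it is a difference of differentials, and symmetric by definition.\<close>
  define b where "b p v = q (p + v) - q p - q v" for p v
  have bD: "b p v = D p v - D 0 v" for p v
    using Q[of p 1 v] by (simp add: b_def q_def qQ[of v p, symmetric] Dadd algebra_simps)
  have bcomm: "b p v = b v p" for p v by (simp add: b_def add.commute)
  have cross: "v $ l * q v $ i = v $ i * q v $ l" for v i l
  proof -
    have *: "v $ l * q v $ i = v $ i * q v $ l" if vl: "v $ l \<noteq> 0" and il: "i \<noteq> l" for v i l
    proof -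
      define y where "y s = (\<chi> j. if j = l then s / v $ l else v $ j / v $ l)" for s
      \<comment> \<open>The change of charts at the point \<open>v / s\<close>; only the quadratic part survives at \<open>s = 0\<close>, the point at infinity.\<close>
      define G where "G s = s * (X (Some l) (y s) $ i * (v $ l)\<^sup>2)
          - s\<^sup>2 * (F 0 $ i * v $ l - v $ i * F 0 $ l) - s * (D 0 v $ i * v $ l - v $ i * D 0 v $ l)" for s
      have "continuous_on UNIV (\<lambda>s. if j = l then s / v $ l else v $ j / v $ l)" for j
        using vl by (cases "j = l") (auto intro!: continuous_intros)
      hence "continuous_on UNIV y" unfolding y_def by (intro continuous_on_vec_lambda)
      hence "continuous_on UNIV (\<lambda>s. X (Some l) (y s))"
        by (intro continuous_on_compose2[OF entire_map_continuous[OF holo_vector_fields_entire[OF X]]]) auto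
      hence "continuous_on UNIV G" unfolding G_def by (intro continuous_intros)
      moreover have "G s = q v $ i * v $ l - v $ i * q v $ l" if s: "s \<noteq> 0" for s
      proof -
        define x where "x = (1 / s) *s v"
        have nz: "hom_coord None x $ Some l \<noteq> 0" using vl s by (simp add: x_def)
        have "aff_coord (Some l) (hom_coord None x) = y s"
          using vl s by (auto simp: y_def aff_coord_def slot_def hom_coord_def vec_eq_iff x_def)
        hence "X (Some l) (y s) $ i = (F x $ i * x $ l - x $ i * F x $ l) / (x $ l)\<^sup>2"
          using holo_vector_fields_change[OF X nz, of i] il by (simp add: slot_def F_def)
        moreover have "F x = F 0 + (1 / s) *s D 0 v + (1 / s)\<^sup>2 *s q v"
          using F_q[of x] by (simp only: x_def Dscale qscale)
        ultimately have "X (Some l) (y s) $ i =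
            ((F 0 $ i + D 0 v $ i / s + q v $ i / s\<^sup>2) * (v $ l / s)
              - v $ i / s * (F 0 $ l + D 0 v $ l / s + q v $ l / s\<^sup>2)) / (v $ l / s)\<^sup>2"
          by (simp add: x_def power_divide)
        moreover have "s * (((a1 + a2 / s + a3 / s\<^sup>2) * (c / s) - d / s * (b1 + b2 / s + b3 / s\<^sup>2)) / (c / s)\<^sup>2 * c\<^sup>2)
            - s\<^sup>2 * (a1 * c - d * b1) - s * (a2 * c - d * b2) = a3 * c - d * b3"
          if "c \<noteq> 0" for a1 a2 a3 b1 b2 b3 c d :: complex
          using s that by (simp add: field_simps power2_eq_square)
        ultimately show ?thesis using vl by (simp only: G_def)
      qed
      ultimately have "G 0 = q v $ i * v $ l - v $ i * q v $ l" by (rule continuous_punctured_const)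
      thus ?thesis by (simp add: G_def algebra_simps)
    qed
    show ?thesis
    proof (cases "i = l \<or> v $ l = 0 \<and> v $ i = 0")
      case False
      thus ?thesis using *[of v l i] *[of v i l, symmetric] by blast
    qed auto
  qed
  have qvan: "q v $ i = 0" if "v $ i = 0" for v i
  proof (cases "v = 0")
    case True
    thus ?thesis using vec.linear_0[OF D] by (simp add: q_def)
  next
    case False
    then obtain l where "v $ l \<noteq> 0" by (auto simp: vec_eq_iff)
    thus ?thesis using cross[of v l i] that by simp
  qed
  define g where "g i x = b (axis i 1) (x - x $ i *s axis i 1) $ i + x $ i * q (axis i 1) $ i" for i x
  have q_g: "q x $ i = x $ i * g i x" for x i
  proof -
    define x' where "x' = x - x $ i *s axis i 1"
    have x': "x' $ i = 0" "x = x' + x $ i *s axis i 1" by (simp_all add: x'_def axis_def)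
    have "q x $ i = (b x' (x $ i *s axis i 1) + q x' + q (x $ i *s axis i 1)) $ i"
      unfolding b_def by (subst x'(2)) simp
    also have "b x' (x $ i *s axis i 1) = x $ i *s b x' (axis i 1)"
      unfolding bD by (simp add: Dscale vec.scale_right_diff_distrib)
    also have "b x' (axis i 1) = b (axis i 1) x'" by (rule bcomm)
    finally show ?thesis using qvan[OF x'(1)]
      by (simp add: g_def x'_def[symmetric] qscale power2_eq_square algebra_simps)
  qed
  have glin: "g i (x + y) = g i x + g i y" "g i (c *s x) = c * g i x" for i x y c
  proof -
    define r where "r x = x - x $ i *s axis i 1" for x :: "complex^'m"
    have r: "r (x + y) = r x + r y" "r (c *s x) = c *s r x"
      by (simp_all add: r_def vec_eq_iff algebra_simps)
    have g: "g i x = D (axis i 1) (r x) $ i - D 0 (r x) $ i + x $ i * q (axis i 1) $ i" for x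
      by (simp add: g_def bD r_def)
    show "g i (x + y) = g i x + g i y" unfolding g r by (simp add: Dadd algebra_simps)
    show "g i (c *s x) = c * g i x" unfolding g r by (simp add: Dscale algebra_simps)
  qed
  have gg: "g i x = g l x" for i l x
  proof -
    have *: "g i x = g l x" if "x $ i \<noteq> 0" "x $ l \<noteq> 0" for x
      using cross[of x l i] that by (simp add: q_g)
    obtain t where t: "t \<notin> {0, - (x $ i), - (x $ l)}"
      using ex_new_if_finite[OF infinite_UNIV_char_0, of "{0, - (x $ i), - (x $ l)}"] by blast
    define w :: "complex^'m" where "w = (\<chi> j. t)"
    have "g i (x + w) = g l (x + w)"
      using t by (intro *) (auto simp: w_def add_eq_0_iff2)
    moreover have "g i w = g l w" using t by (intro *) (auto simp: w_def)
    ultimately show ?thesis by (simp add: glin)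
  qed
  obtain i0 :: 'm where True by simp
  define \<gamma> where "\<gamma> = (\<chi> j. g i0 (axis j 1))"
  have g\<gamma>: "g i x = linear_form \<gamma> x" for i x
    unfolding gg[of i x i0] \<gamma>_def by (rule scale_vec_functional) (simp_all add: glin)
  have D0: "D 0 x $ i = linear_form (\<chi> j. D 0 (axis j 1) $ i) x" for x i
    by (rule scale_vec_functional) (simp_all add: Dadd Dscale)
  define B :: "complex^'m option^'m option" where
    "B = (\<chi> r s. case r of
         None \<Rightarrow> (case s of None \<Rightarrow> 0 | Some j \<Rightarrow> - \<gamma> $ j)
       | Some i \<Rightarrow> (case s of None \<Rightarrow> F 0 $ i | Some j \<Rightarrow> D 0 (axis j 1) $ i))"
  have "linear_field B None x $ i = F x $ i" for x i
    unfolding F_q[of x] vector_add_component q_g g\<gamma> D0[of x i]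
    by (simp add: linear_field_def matrix_vector_mult_def sum_option B_def linear_form_def sum_negf)
  thus ?thesis by (intro exI[of _ B]) (simp add: fun_eq_iff vec_eq_iff F_def)
qed

lemma continuous_on_hom_coord: "continuous_on S (hom_coord k)"
proof -
  have "continuous_on S (\<lambda>x. if j = k then 1 else x $ (THE i. slot k i = j))" for j
    by (cases "j = k") (auto intro!: continuous_intros)
  thus ?thesis unfolding hom_coord_def by (intro continuous_on_vec_lambda)
qed

text \<open>The standard chart is dense in each of the other charts, so the identity of the fields there
  extends by continuity.\<close>

theorem holo_vector_fields_linear:
  fixes X :: "('m::finite) chart_field"
  assumes X: "X \<in> holo_vector_fields"
  shows "\<exists>B. X = linear_field B"
proof -
  obtain B where B: "X None = linear_field B None"
    using holo_vector_fields_chart_None[OF X] by blast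
  have lin_cont: "continuous_on S (linear_field B k)" for S k
    unfolding linear_field_def matrix_vector_mult_def
    by (intro continuous_intros continuous_on_hom_coord)
  have gen: "X (Some l) y = linear_field B (Some l) y" if y: "y $ l \<noteq> 0" for l y
  proof -
    define h where "h = hom_coord (Some l) y"
    have h0: "h $ None = y $ l" using hom_coord_nth(2)[of "Some l" y l] by (simp add: h_def)
    define x where "x = aff_coord None h"
    have w: "hom_coord None x = (1 / y $ l) *s h" using hom_aff[of h None] h0 y by (simp add: x_def)
    have nz: "hom_coord None x $ Some l \<noteq> 0" using y by (simp add: w h_def)
    have yx: "aff_coord (Some l) (hom_coord None x) = y"
      unfolding w using y by (subst aff_scale) (simp_all add: h_def)
    have "X (Some l) (aff_coord (Some l) (hom_coord None x)) $ i =
        linear_field B (Some l) (aff_coord (Some l) (hom_coord None x)) $ i" for i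
      unfolding holo_vector_fields_change[OF X nz] B
        linear_field_aff_coord[OF nz hom_dir_linear_field[of None B x]] by simp
    thus ?thesis unfolding yx by (simp add: vec_eq_iff)
  qed
  have "X k y = linear_field B k y" for k y
  proof (cases k)
    case None
    thus ?thesis using B by simp
  next
    case (Some l)
    show ?thesis
    proof (cases "y $ l = 0")
      case True
      define f where "f s = X k (y + s *s axis l 1) - linear_field B k (y + s *s axis l 1)" for s
      have "continuous_on UNIV f" unfolding f_def
        by (intro continuous_intros continuous_on_compose2[OF lin_cont[of UNIV]]
            continuous_on_compose2[OF entire_map_continuous[OF holo_vector_fields_entire[OF X], of UNIV]]) auto
      moreover have "f s = 0" if "s \<noteq> 0" for s
        unfolding f_def Some using that True by (subst gen) simp_all
      ultimately have "f 0 = 0" by (rule continuous_punctured_const)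
      thus ?thesis by (simp add: f_def)
    qed (simp add: gen Some)
  qed
  thus ?thesis by blast
qed

section \<open>Flows of linear vector fields\<close>

definition mpow :: "complex^'n^'n \<Rightarrow> nat \<Rightarrow> complex^'n^'n" where
  "mpow B n = (((**) B) ^^ n) (mat 1)"

text \<open>The matrix exponential \<open>exp(s B)\<close>, with entries given as power series in the complex variable \<open>s\<close>, so
  that complex differentiability in \<open>s\<close> is immediate.\<close>

definition mexp :: "complex^'n^'n \<Rightarrow> complex \<Rightarrow> complex^'n^'n" where
  "mexp B s = (\<chi> i j. \<Sum>n. mpow B n $ i $ j / fact n * s ^ n)"

lemma mpow_0 [simp]: "mpow B 0 = mat 1"
  by (simp add: mpow_def)

lemma mpow_Suc: "mpow B (Suc n) = B ** mpow B n"
  by (simp add: mpow_def)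

lemma mpow_Suc2: "mpow B (Suc n) = mpow B n ** B"
  by (induction n) (simp_all add: mpow_Suc matrix_mul_assoc)

lemma mexp_summable: "summable (\<lambda>n. mpow B n $ i $ j / fact n * s ^ n)"
proof -
  define K where "K = (\<Sum>i\<in>UNIV. \<Sum>j\<in>UNIV. norm (B $ i $ j))"
  have K: "(\<Sum>j\<in>UNIV. norm (B $ i $ j)) \<le> K" for i
    unfolding K_def by (rule member_le_sum) (auto intro: sum_nonneg)
  have K0: "0 \<le> K" unfolding K_def by (intro sum_nonneg) auto
  have bound: "norm (mpow B n $ i $ j) \<le> K ^ n" for n i j
  proof (induction n arbitrary: i)
    case 0
    thus ?case by (simp add: mat_def)
  next
    case (Suc n)
    have "norm (mpow B (Suc n) $ i $ j) \<le> (\<Sum>k\<in>UNIV. norm (B $ i $ k * mpow B n $ k $ j))"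
      by (simp add: mpow_Suc matrix_matrix_mult_def sum_norm_le)
    also have "\<dots> \<le> (\<Sum>k\<in>UNIV. norm (B $ i $ k) * K ^ n)"
      unfolding norm_mult by (intro sum_mono mult_left_mono Suc.IH) auto
    also have "\<dots> \<le> K * K ^ n"
      unfolding sum_distrib_right[symmetric] using K0 by (intro mult_right_mono K) auto
    finally show ?case by simp
  qed
  show ?thesis
  proof (rule summable_comparison_test')
    show "summable (\<lambda>n. inverse (fact n) * (K * norm s) ^ n)" by (rule summable_exp)
    show "norm (mpow B n $ i $ j / fact n * s ^ n) \<le> inverse (fact n) * (K * norm s) ^ n" for n
      using mult_right_mono[OF bound[of n i j], of "norm s ^ n / fact n"]
      by (simp add: norm_mult norm_divide norm_power power_mult_distrib field_simps)
  qed
qed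

lemma mexp_deriv_aux:
  "((\<lambda>s. mexp B s $ i $ j) has_field_derivative (\<Sum>n. mpow B (Suc n) $ i $ j / fact n * s ^ n)) (at s)"
proof -
  have "diffs (\<lambda>n. mpow B n $ i $ j / fact n) = (\<lambda>n. mpow B (Suc n) $ i $ j / fact n)"
    by (simp add: diffs_def fun_eq_iff field_simps del: of_nat_Suc)
  thus ?thesis
    using termdiffs_strong_converges_everywhere[OF mexp_summable[of B i j], of s]
    by (simp only: mexp_def vec_lambda_beta)
qed

lemma mexp_deriv_left:
  "((\<lambda>s. mexp B s $ i $ j) has_field_derivative (B ** mexp B s) $ i $ j) (at s)"
proof -
  have "(\<Sum>n. mpow B (Suc n) $ i $ j / fact n * s ^ n)
      = (\<Sum>n. \<Sum>k\<in>UNIV. B $ i $ k * (mpow B n $ k $ j / fact n * s ^ n))"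
    by (simp add: mpow_Suc matrix_matrix_mult_def sum_divide_distrib sum_distrib_right mult.assoc)
  also have "\<dots> = (\<Sum>k\<in>UNIV. \<Sum>n. B $ i $ k * (mpow B n $ k $ j / fact n * s ^ n))"
    by (intro suminf_sum summable_mult mexp_summable)
  also have "\<dots> = (B ** mexp B s) $ i $ j"
    by (simp only: suminf_mult[OF mexp_summable] matrix_matrix_mult_def mexp_def vec_lambda_beta)
  finally show ?thesis using mexp_deriv_aux[of B i j s] by simp
qed

lemma mexp_deriv_right:
  "((\<lambda>s. mexp B s $ i $ j) has_field_derivative (mexp B s ** B) $ i $ j) (at s)"
proof -
  have "(\<Sum>n. mpow B (Suc n) $ i $ j / fact n * s ^ n)
      = (\<Sum>n. \<Sum>k\<in>UNIV. B $ k $ j * (mpow B n $ i $ k / fact n * s ^ n))"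
    by (simp add: mpow_Suc2 matrix_matrix_mult_def sum_divide_distrib sum_distrib_left mult_ac)
  also have "\<dots> = (\<Sum>k\<in>UNIV. \<Sum>n. B $ k $ j * (mpow B n $ i $ k / fact n * s ^ n))"
    by (intro suminf_sum summable_mult mexp_summable)
  also have "\<dots> = (\<Sum>k\<in>UNIV. B $ k $ j * mexp B s $ i $ k)"
    by (simp only: suminf_mult[OF mexp_summable] mexp_def vec_lambda_beta)
  also have "\<dots> = (mexp B s ** B) $ i $ j"
    by (simp add: matrix_matrix_mult_def mult.commute)
  finally show ?thesis using mexp_deriv_aux[of B i j s] by simp
qed

lemma mexp_0 [simp]: "mexp B 0 = mat 1"
  by (simp only: mexp_def vec_eq_iff vec_lambda_beta powser_zero mpow_0) simp

lemma mexp_conj_deriv: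
  "((\<lambda>s. (mexp B s ** C ** mexp B (- s)) $ i $ j) has_field_derivative
     (mexp B s ** (B ** C - C ** B) ** mexp B (- s)) $ i $ j) (at s)"
proof -
  have R: "((\<lambda>s. mexp B (- s) $ k $ j) has_field_derivative - (B ** mexp B (- s)) $ k $ j) (at s)" for k
    using DERIV_chain2[where f = "\<lambda>s. mexp B s $ k $ j" and g = "\<lambda>s. - s",
        OF mexp_deriv_left DERIV_minus[OF DERIV_ident], of s UNIV] by simp
  have E: "(X ** C ** Y) $ i $ j = (\<Sum>k\<in>UNIV. (\<Sum>l\<in>UNIV. X $ i $ l * C $ l $ k) * Y $ k $ j)" for X Y
    by (simp add: matrix_matrix_mult_def)
  have "((\<lambda>s. \<Sum>k\<in>UNIV. (\<Sum>l\<in>UNIV. mexp B s $ i $ l * C $ l $ k) * mexp B (- s) $ k $ j) has_field_derivative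
      (\<Sum>k\<in>UNIV. (\<Sum>l\<in>UNIV. (mexp B s ** B) $ i $ l * C $ l $ k) * mexp B (- s) $ k $ j
        + (- (B ** mexp B (- s)) $ k $ j) * (\<Sum>l\<in>UNIV. mexp B s $ i $ l * C $ l $ k))) (at s)"
    by (intro DERIV_sum DERIV_mult DERIV_cmult_right R mexp_deriv_right)
  moreover have "(\<Sum>k\<in>UNIV. (\<Sum>l\<in>UNIV. (mexp B s ** B) $ i $ l * C $ l $ k) * mexp B (- s) $ k $ j
        + (- (B ** mexp B (- s)) $ k $ j) * (\<Sum>l\<in>UNIV. mexp B s $ i $ l * C $ l $ k))
      = ((mexp B s ** B) ** C ** mexp B (- s) - (mexp B s ** C) ** (B ** mexp B (- s))) $ i $ j"
    by (simp add: E sum_subtractf mult.commute)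
  moreover have "(mexp B s ** B) ** C ** mexp B (- s) - (mexp B s ** C) ** (B ** mexp B (- s))
      = mexp B s ** (B ** C - C ** B) ** mexp B (- s)"
    by (simp add: matrix_mul_assoc matrix_eq matrix_vector_mult_diff_rdistrib
        matrix_vector_mul_assoc[symmetric] matrix_vector_mult_diff_distrib)
  ultimately show ?thesis unfolding E by simp
qed

lemma mexp_inverse: "mexp B (- s) ** mexp B s = mat 1"
proof -
  have "mexp B s ** mat 1 ** mexp B (- s) = mat 1" for s
  proof -
    have "(mexp B s ** mat 1 ** mexp B (- s)) $ i $ j = mat 1 $ i $ j" for i j
    proof -
      have "((\<lambda>s. (mexp B s ** mat 1 ** mexp B (- s)) $ i $ j) has_field_derivative 0) (at s)" for s
        using mexp_conj_deriv[of B "mat 1" i j s] by simp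
      then obtain c where "\<And>s. (mexp B s ** mat 1 ** mexp B (- s)) $ i $ j = c"
        using has_field_derivative_zero_constant[of UNIV "\<lambda>s. (mexp B s ** mat 1 ** mexp B (- s)) $ i $ j"]
        by auto
      from this[of s] this[of 0] show ?thesis by simp
    qed
    thus ?thesis by (simp only: vec_eq_iff) simp
  qed
  from this[of "- s"] show ?thesis by simp
qed

lemma linear_form_matrix_mult: "linear_form a (M *v z) = (\<Sum>i\<in>UNIV. \<Sum>j\<in>UNIV. a $ i * z $ j * M $ i $ j)"
  by (simp add: linear_form_def matrix_vector_mult_def sum_distrib_left mult_ac)

text \<open>The function \<open>s \<mapsto> \<omega>\<^sub>z(exp(s B) C exp(-s B) z)\<close> is entire, and its \<open>n\<close>-th derivative at \<open>0\<close> is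
  \<open>\<omega>\<^sub>z\<close> applied to the \<open>n\<close>-fold commutator \<open>[B, [B, \<dots> [B, C]]]\<close> at \<open>z\<close>, which is zero.\<close>

lemma mexp_conj_tangent:
  assumes G: "\<And>C z. C \<in> G \<Longrightarrow> linear_form (A z) (C *v z) = 0"
    and comm: "\<And>B C. B \<in> G \<Longrightarrow> C \<in> G \<Longrightarrow> B ** C - C ** B \<in> G"
    and B: "B \<in> G" and C: "C \<in> G"
  shows "linear_form (A z) ((mexp B s ** C ** mexp B (- s)) *v z) = 0"
proof -
  define \<phi> where "\<phi> C s = linear_form (A z) ((mexp B s ** C ** mexp B (- s)) *v z)" for C s
  have \<phi>': "(\<phi> C has_field_derivative \<phi> (B ** C - C ** B) s) (at s)" for C s
    unfolding \<phi>_def[abs_def] linear_form_matrix_mult by (intro DERIV_sum DERIV_cmult mexp_conj_deriv)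
  define ad where "ad n = ((\<lambda>C. B ** C - C ** B) ^^ n) C" for n
  have ad: "ad n \<in> G" for n by (induction n) (simp_all add: ad_def C B comm)
  have "(deriv ^^ n) (\<phi> C) = \<phi> (ad n)" for n
  proof (induction n)
    case (Suc n)
    have "deriv (\<phi> (ad n)) = \<phi> (ad (Suc n))"
      using \<phi>'[of "ad n"] by (simp add: fun_eq_iff ad_def DERIV_imp_deriv)
    thus ?case using Suc by simp
  qed (simp add: ad_def)
  moreover have "\<phi> (ad n) 0 = 0" for n using G[OF ad[of n]] by (simp add: \<phi>_def)
  moreover have "\<phi> C holomorphic_on UNIV" using \<phi>' by (auto simp: holomorphic_on_open)
  ultimately have "\<phi> C s = 0"
    by (intro holomorphic_fun_eq_0_on_connected[of "\<phi> C" UNIV 0 s]) (simp_all add: convex_connected)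
  thus ?thesis by (simp add: \<phi>_def)
qed

text \<open>Along the flow, \<open>a\<close> solves the scalar equation \<open>g' = c g\<close>.\<close>

lemma mexp_invariant_hyperplane:
  assumes c: "\<And>z. linear_form a (B *v z) = c * linear_form a z" and z: "linear_form a z = 0"
  shows "linear_form a (mexp B s *v z) = 0"
proof -
  define g where "g s = linear_form a (mexp B s *v z)" for s
  have g': "(g has_field_derivative c * g s) (at s)" for s
  proof -
    have "(g has_field_derivative linear_form a ((B ** mexp B s) *v z)) (at s)"
      unfolding g_def[abs_def] linear_form_matrix_mult by (intro DERIV_sum DERIV_cmult mexp_deriv_left)
    thus ?thesis by (simp add: g_def matrix_vector_mul_assoc[symmetric] c)
  qed
  have "((\<lambda>s. g s * exp (- c * s)) has_field_derivative 0) (at s)" for s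
    by (auto intro!: derivative_eq_intros g' simp: algebra_simps)
  then obtain d where d: "\<And>s. g s * exp (- c * s) = d"
    using has_field_derivative_zero_constant[of UNIV "\<lambda>s. g s * exp (- c * s)"] by auto
  have "d = 0" using d[of 0] z by (simp add: g_def)
  thus ?thesis using d[of s] by (simp add: g_def)
qed

lemma has_derivative_vec_componentwise:
  fixes f :: "complex^'n \<Rightarrow> complex^'m"
  assumes "\<And>i. ((\<lambda>x. f x $ i) has_derivative (\<lambda>h. f' h $ i)) (at x)"
  shows "(f has_derivative f') (at x)"
proof -
  have "bounded_linear (\<lambda>h. f' h $ i)" for i using assms has_derivative_bounded_linear by blast
  hence lin: "linear (\<lambda>h. f' h $ i)" for i by (simp add: linear_conv_bounded_linear)
  have "linear f'"
    by (rule linearI) (simp_all add: vec_eq_iff linear_add[OF lin] linear_scale[OF lin])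
  hence "bounded_linear f'" by (simp add: linear_conv_bounded_linear)
  moreover have "((\<lambda>y. (f y - f x - f' (y - x)) /\<^sub>R norm (y - x)) \<longlongrightarrow> 0) (at x)"
  proof (rule vec_tendstoI)
    fix i
    show "((\<lambda>y. ((f y - f x - f' (y - x)) /\<^sub>R norm (y - x)) $ i) \<longlongrightarrow> 0 $ i) (at x)"
      using assms[of i] by (simp add: has_derivative_at_within)
  qed
  ultimately show ?thesis by (simp add: has_derivative_at_within)
qed

context
  fixes k :: "'n::finite" and e z0 :: "complex^'n" and Bs :: "'n \<Rightarrow> complex^'n^'n"
begin

text \<open>The map \<open>s \<mapsto> exp(s\<^sub>j B\<^sub>j) \<dots> (z\<^sub>0 + s\<^sub>k e)\<close>, the factors running through the list. The coordinate with the
  distinguished index \<open>k\<close> is used for the transversal direction \<open>e\<close>, so that source and target have the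
  same type and the inverse function theorem applies.\<close>

fun flow_map :: "'n list \<Rightarrow> complex^'n \<Rightarrow> complex^'n" where
  "flow_map [] s = z0 + s $ k *s e"
| "flow_map (j # l) s = mexp (Bs j) (s $ j) *v flow_map l s"

fun flow_deriv :: "'n list \<Rightarrow> complex^'n \<Rightarrow> complex^'n \<Rightarrow> complex^'n" where
  "flow_deriv [] s u = u $ k *s e"
| "flow_deriv (j # l) s u =
     u $ j *s (Bs j *v flow_map (j # l) s) + mexp (Bs j) (s $ j) *v flow_deriv l s u"

lemma flow_map_has_derivative: "(flow_map l has_derivative flow_deriv l s) (at s)"
proof (induction l)
  case Nil
  show ?case
    by (rule has_derivative_vec_componentwise)
      (auto intro!: derivative_eq_intros bounded_linear.has_derivative[OF bounded_linear_vec_nth])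
next
  case (Cons j l)
  show ?case
  proof (rule has_derivative_vec_componentwise)
    fix i
    have E: "((\<lambda>s. mexp (Bs j) (s $ j) $ i $ r) has_derivative
        (\<lambda>h. h $ j * (Bs j ** mexp (Bs j) (s $ j)) $ i $ r)) (at s)" for r
      using has_derivative_compose[OF bounded_linear_imp_has_derivative[OF bounded_linear_vec_nth[of j], of "at s"]
          mexp_deriv_left[of "Bs j" i r "s $ j", unfolded has_field_derivative_def]]
      by (simp add: mult.commute)
    have F: "((\<lambda>s. flow_map l s $ r) has_derivative (\<lambda>h. flow_deriv l s h $ r)) (at s)" for r
      by (rule bounded_linear.has_derivative[OF bounded_linear_vec_nth Cons])
    have "((\<lambda>s. \<Sum>r\<in>UNIV. mexp (Bs j) (s $ j) $ i $ r * flow_map l s $ r) has_derivative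
      (\<lambda>h. \<Sum>r\<in>UNIV. mexp (Bs j) (s $ j) $ i $ r * flow_deriv l s h $ r
        + h $ j * (Bs j ** mexp (Bs j) (s $ j)) $ i $ r * flow_map l s $ r)) (at s)"
      by (intro has_derivative_sum has_derivative_mult E F)
    moreover have "(\<Sum>r\<in>UNIV. mexp (Bs j) (s $ j) $ i $ r * flow_deriv l s h $ r
        + h $ j * (Bs j ** mexp (Bs j) (s $ j)) $ i $ r * flow_map l s $ r) = flow_deriv (j # l) s h $ i" for h
      by (simp add: matrix_vector_mul_assoc)
        (simp add: matrix_vector_mult_def sum.distrib sum_distrib_left mult_ac)
    ultimately show "((\<lambda>s. flow_map (j # l) s $ i) has_derivative (\<lambda>h. flow_deriv (j # l) s h $ i)) (at s)"
      by (simp add: matrix_vector_mult_def)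
  qed
qed

lemma continuous_on_flow_map: "continuous_on S (flow_map l)"
  by (meson continuous_at_imp_continuous_on flow_map_has_derivative has_derivative_continuous)

lemma continuous_on_mexp_entry: "continuous_on S (\<lambda>s :: complex^'n. mexp B (s $ j) $ i $ r)"
proof -
  have "continuous_on UNIV (\<lambda>s. mexp B s $ i $ r)"
    by (rule DERIV_continuous_on[OF has_field_derivative_at_within[OF mexp_deriv_left]])
  thus ?thesis by (rule continuous_on_compose2) (auto intro!: continuous_intros)
qed

lemma continuous_on_flow_deriv: "continuous_on S (\<lambda>s. flow_deriv l s u)"
proof (induction l)
  case (Cons j l)
  have "continuous_on S (\<lambda>s. Bs j *v flow_map (j # l) s)"
    using continuous_on_flow_map[of S "j # l"] unfolding matrix_vector_mult_def
    by (intro continuous_intros)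
  moreover have "continuous_on S (\<lambda>s. mexp (Bs j) (s $ j) *v flow_deriv l s u)"
    using Cons unfolding matrix_vector_mult_def by (intro continuous_intros continuous_on_mexp_entry)
  ultimately show ?case by (auto intro!: continuous_intros)
qed (auto intro!: continuous_intros)

lemma flow_map_0: "flow_map l 0 = z0"
  by (induction l) simp_all

lemma flow_deriv_0:
  "distinct l \<Longrightarrow> flow_deriv l 0 u = u $ k *s e + (\<Sum>j\<in>set l. u $ j *s (Bs j *v z0))"
  by (induction l) (simp_all add: flow_map_0 flow_map_0[of "_ # _", simplified] algebra_simps)

lemma flow_map_hyperplane:
  assumes "\<And>j. \<exists>c. \<forall>z. linear_form a (Bs j *v z) = c * linear_form a z"
    and "linear_form a z0 = 0" "s $ k = 0"
  shows "linear_form a (flow_map l s) = 0"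
proof (induction l)
  case (Cons j l)
  obtain c where c: "\<And>z. linear_form a (Bs j *v z) = c * linear_form a z" using assms(1) by blast
  show ?case using mexp_invariant_hyperplane[OF c Cons] by simp
qed (simp add: assms)

text \<open>The outermost factor moves its own parameter in the direction \<open>B\<^sub>j w\<close> and carries a vector \<open>C y\<close> to
  \<open>(P C P\<^sup>-\<^sup>1) (P y)\<close> with \<open>P = exp(s\<^sub>j B\<^sub>j)\<close>; both are values of members of \<open>G\<close>, which contains
  all matrices that are tangent everywhere.\<close>

lemma flow_deriv_tangent:
  assumes G: "\<And>C z. C \<in> G \<Longrightarrow> linear_form (A z) (C *v z) = 0"
    and all: "\<And>C. (\<And>z. linear_form (A z) (C *v z) = 0) \<Longrightarrow> C \<in> G"
    and comm: "\<And>B C. B \<in> G \<Longrightarrow> C \<in> G \<Longrightarrow> B ** C - C ** B \<in> G"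
    and Bs: "\<And>j. j \<in> set l \<Longrightarrow> Bs j \<in> G" and u: "u $ k = 0"
  shows "\<exists>C\<in>G. flow_deriv l s u = C *v flow_map l s"
  using Bs
proof (induction l)
  case Nil
  have "0 \<in> G" by (rule all) simp
  thus ?case using u by force
next
  case (Cons j l)
  then obtain C where C: "C \<in> G" "flow_deriv l s u = C *v flow_map l s" by auto
  have Bj: "Bs j \<in> G" using Cons.prems by simp
  let ?P = "mexp (Bs j) (s $ j)" and ?R = "mexp (Bs j) (- (s $ j))"
  have "?P *v (C *v flow_map l s) = (?P ** C ** ?R) *v (?P *v flow_map l s)"
    by (simp add: matrix_vector_mul_assoc matrix_mul_assoc[symmetric] mexp_inverse)
  hence "flow_deriv (j # l) s u = (mat (u $ j) ** Bs j + ?P ** C ** ?R) *v flow_map (j # l) s"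
    using C(2) by (simp add: matrix_vector_mult_add_rdistrib matrix_vector_mul_assoc[symmetric] mat_mult_vec)
  moreover have "mat (u $ j) ** Bs j + ?P ** C ** ?R \<in> G"
    using mexp_conj_tangent[of G A, OF G comm Bj C(1)] G[OF Bj]
    by (intro all) (simp add: matrix_vector_mult_add_rdistrib matrix_vector_mul_assoc[symmetric, of "mat _"] mat_mult_vec)
  ultimately show ?case by blast
qed

end

section \<open>A local first integral\<close>

lemma linear_form_sum: "linear_form a (\<Sum>i\<in>I. f i) = (\<Sum>i\<in>I. linear_form a (f i))"
  by (induction I rule: infinite_finite_induct) simp_all

lemma flow_deriv_add:
  "flow_deriv k e z0 Bs l s (u + v) = flow_deriv k e z0 Bs l s u + flow_deriv k e z0 Bs l s v"
  by (induction l) (simp_all add: vec.scale_left_distrib matrix_vector_right_distrib)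

lemma flow_deriv_scale:
  "flow_deriv k e z0 Bs l s (c *s u) = c *s flow_deriv k e z0 Bs l s u"
  by (induction l) (simp_all add: vec.scale_right_distrib vector_scalar_commute)

text \<open>The transversal coordinate of the local inverse of \<open>flow_map\<close>. Its differential kills the kernel of
  \<open>\<omega>\<close>: modulo tangent vectors every vector is a multiple of the image of the transversal direction,
  and \<open>\<omega>\<close> is nonzero on that image near \<open>z\<^sub>0\<close>.\<close>

lemma local_first_integral:
  fixes A :: "complex^'n \<Rightarrow> complex^'n"
  assumes contA: "continuous_on UNIV A"
    and G: "\<And>C. C \<in> G \<longleftrightarrow> (\<forall>z. linear_form (A z) (C *v z) = 0)"
    and comm: "\<And>B C. B \<in> G \<Longrightarrow> C \<in> G \<Longrightarrow> B ** C - C ** B \<in> G"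
    and inv: "\<And>C. C \<in> G \<Longrightarrow> \<exists>c. \<forall>z. linear_form a (C *v z) = c * linear_form a z"
    and a: "a \<noteq> 0" and z0: "linear_form a z0 = 0" "A z0 \<noteq> 0"
    and span: "\<And>u. linear_form a u = 0 \<Longrightarrow> \<exists>C\<in>G. u = C *v z0"
  shows "\<exists>V F. open V \<and> z0 \<in> V \<and> F z0 = (0::complex) \<and>
    (\<forall>z\<in>V. F z = 0 \<longrightarrow> linear_form a z = 0) \<and>
    (\<forall>z\<in>V. \<exists>F'. (F has_derivative F') (at z) \<and> (\<forall>u. linear_form (A z) u = 0 \<longrightarrow> F' u = 0))"
proof -
  obtain k where k: "a $ k \<noteq> 0" using a by (auto simp: vec_eq_iff)
  define e where "e = axis k (1 / a $ k)"
  have ae: "linear_form a e = 1" using k by (simp add: e_def)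
  \<comment> \<open>Together with \<open>e\<close> the vectors \<open>w j\<close> for \<open>j \<noteq> k\<close> form a basis; they span \<open>ker a\<close>.\<close>
  define w where "w j = axis j 1 - (a $ j / a $ k) *s axis k 1" for j
  have aw: "linear_form a (w j) = 0" for j using k by (simp add: w_def)
  have "\<forall>j. \<exists>C. C \<in> G \<and> C *v z0 = w j" using span[OF aw] by metis
  then obtain Bs where Bs: "\<And>j. Bs j \<in> G" "\<And>j. Bs j *v z0 = w j" by metis
  obtain l where l: "set l = UNIV - {k}" "distinct l"
    using finite_distinct_list[of "UNIV - {k}"] by auto
  define f where "f = flow_map k e z0 Bs l"
  define df where "df = flow_deriv k e z0 Bs l"
  define D where "D s = Blinfun (df s)" for s
  have der: "(f has_derivative df s) (at s)" for s
    unfolding f_def df_def by (rule flow_map_has_derivative)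
  have D: "blinfun_apply (D s) = df s" for s
    unfolding D_def by (rule bounded_linear_Blinfun_apply[OF has_derivative_bounded_linear[OF der]])
  have "continuous_on UNIV D"
    by (intro continuous_on_blinfun_componentwise) (simp add: D df_def continuous_on_flow_deriv)
  \<comment> \<open>The inverse of the differential at the origin: \<open>a\<close> recovers the transversal coordinate.\<close>
  define iv where "iv y = (\<chi> j. if j = k then linear_form a y else y $ j)" for y :: "complex^'n"
  have "linear iv"
    by (rule linearI) (simp_all add: iv_def vec_eq_iff scaleR_vec scaleR_conv_of_real[where 'a = complex])
  hence iv: "blinfun_apply (Blinfun iv) = iv"
    by (intro bounded_linear_Blinfun_apply) (simp add: linear_conv_bounded_linear)
  have df0: "df 0 u = u $ k *s e + (\<Sum>j\<in>UNIV - {k}. u $ j *s w j)" for u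
    unfolding df_def using flow_deriv_0[OF l(2)] by (simp add: l(1) Bs(2))
  have "iv (df 0 u) $ j = u $ j" for u j
  proof (cases "j = k")
    case True
    thus ?thesis by (simp add: iv_def df0 linear_form_sum ae aw)
  next
    case False
    have "(\<Sum>i\<in>UNIV - {k}. u $ i * w i $ j) = (\<Sum>i\<in>UNIV - {k}. if i = j then u $ j else 0)"
      using False by (intro sum.cong) (auto simp: w_def axis_def)
    thus ?thesis using False by (simp add: iv_def df0 e_def axis_def)
  qed
  hence "iv (df 0 u) = u" for u by (simp add: vec_eq_iff)
  hence "Blinfun iv o\<^sub>L D 0 = id_blinfun" by (intro blinfun_eqI) (simp add: iv D)
  from inverse_function_theorem[OF open_UNIV der[folded D] \<open>continuous_on UNIV D\<close> UNIV_I this]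
  obtain U V g g' where V: "open V" "f 0 \<in> V" and U: "0 \<in> U" and hom: "homeomorphism U V f g"
    and g': "\<And>y. y \<in> V \<Longrightarrow> (g has_derivative g' y) (at y)" "\<And>y. y \<in> V \<Longrightarrow> g' y = inv (blinfun_apply (D (g y)))"
      "\<And>y. y \<in> V \<Longrightarrow> bij (blinfun_apply (D (g y)))"
    by metis
  have f0: "f 0 = z0" by (simp add: f_def flow_map_0)
  have g0: "g z0 = 0" using homeomorphism_apply1[OF hom U] f0 by simp
  have fg: "f (g z) = z" if "z \<in> V" for z using homeomorphism_apply2[OF hom that] .
  define N where "N z = linear_form (A z) (df (g z) (axis k 1))" for z
  have "continuous_on V (\<lambda>z. df (g z) (axis k 1))"
    using continuous_on_compose2[OF continuous_on_flow_deriv[of UNIV] homeomorphism_cont2[OF hom]]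
    by (auto simp: df_def)
  hence "continuous_on V N"
    unfolding N_def linear_form_def
    by (intro continuous_intros continuous_on_subset[OF contA]) auto
  hence openV: "open (V \<inter> N -` (- {0}))"
    using V(1) by (intro continuous_open_preimage) auto
  have "N z0 \<noteq> 0"
  proof
    assume "N z0 = 0"
    hence e0: "linear_form (A z0) e = 0" by (simp add: N_def g0 df0 axis_def cong: if_cong)
    have "linear_form (A z0) u = 0" for u
    proof -
      obtain C where "C \<in> G" "u - linear_form a u *s e = C *v z0"
        using span[of "u - linear_form a u *s e"] ae by auto
      hence "linear_form (A z0) (u - linear_form a u *s e) = 0" using G by auto
      thus ?thesis using e0 by simp
    qed
    thus False using z0(2) linear_form_eq_0_iff by blast
  qed
  have "\<exists>F'. ((\<lambda>z. g z $ k) has_derivative F') (at z) \<and> (\<forall>u. linear_form (A z) u = 0 \<longrightarrow> F' u = 0)"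
    if z: "z \<in> V" "N z \<noteq> 0" for z
  proof (intro exI conjI allI impI)
    show "((\<lambda>z. g z $ k) has_derivative (\<lambda>u. g' z u $ k)) (at z)"
      by (rule bounded_linear.has_derivative[OF bounded_linear_vec_nth g'(1)[OF z(1)]])
    fix u assume u: "linear_form (A z) u = 0"
    define \<sigma> where "\<sigma> = g' z u"
    have "df (g z) \<sigma> = u"
      using g'(2,3)[OF z(1)] by (simp add: \<sigma>_def D bij_is_surj surj_f_inv_f)
    moreover have "df (g z) \<sigma> = df (g z) (\<sigma> - \<sigma> $ k *s axis k 1) + \<sigma> $ k *s df (g z) (axis k 1)"
      unfolding df_def flow_deriv_scale[symmetric] flow_deriv_add[symmetric] by simp
    moreover have "linear_form (A z) (df (g z) (\<sigma> - \<sigma> $ k *s axis k 1)) = 0"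
    proof -
      have "\<exists>C\<in>G. df (g z) (\<sigma> - \<sigma> $ k *s axis k 1) = C *v f (g z)"
        unfolding df_def f_def by (rule flow_deriv_tangent[where A = A]) (use G comm Bs in auto)
      thus ?thesis using G fg[OF z(1)] by auto
    qed
    ultimately have "\<sigma> $ k * N z = 0" using u unfolding N_def
      by (metis linear_form_add linear_form_scale add_0)
    thus "g' z u $ k = 0" using z(2) by (simp add: \<sigma>_def)
  qed
  moreover have "linear_form a z = 0" if "z \<in> V" "g z $ k = 0" for z
    using flow_map_hyperplane[of a Bs z0 "g z" k e l] inv Bs(1) z0(1) that fg[OF that(1)]
    by (auto simp: f_def)
  ultimately show ?thesis using openV V(2) f0 g0 \<open>N z0 \<noteq> 0\<close>
    by (intro exI[of _ "V \<inter> N -` (- {0})"] exI[of _ "\<lambda>z. g z $ k"]) auto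
qed

text \<open>The parameters at which the path is in \<open>ker a\<close> form a closed set. It is also open: near such a
  parameter the first integral is continuous along the path and has derivative zero up to finitely
  many exceptions, so it stays zero, whatever the length of the path.\<close>

lemma tangent_path_in_hyperplane:
  fixes A :: "complex^('m::finite) option \<Rightarrow> complex^'m option"
  assumes path: "tangent_path A \<gamma>" and start: "linear_form a (\<gamma> 0) = 0"
    and loc: "\<And>z0. linear_form a z0 = 0 \<Longrightarrow> A z0 \<noteq> 0 \<Longrightarrow>
     \<exists>V F. open V \<and> z0 \<in> V \<and> F z0 = (0::complex) \<and> (\<forall>z\<in>V. F z = 0 \<longrightarrow> linear_form a z = 0) \<and>
      (\<forall>z\<in>V. \<exists>F'. (F has_derivative F') (at z) \<and> (\<forall>u. linear_form (A z) u = 0 \<longrightarrow> F' u = 0))"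
    and t: "t \<in> {0..1}"
  shows "linear_form a (\<gamma> t) = 0"
proof -
  have "continuous_on {0..1} \<gamma> \<and> (\<exists>K. finite K \<and> \<gamma> C1_differentiable_on ({0..1} - K))"
    using path by (simp add: tangent_path_def valid_path_def piecewise_C1_differentiable_on_def)
  then obtain K \<gamma>' where cont: "continuous_on {0..1} \<gamma>" and K: "finite K"
    and \<gamma>': "\<And>x. x \<in> {0..1} - K \<Longrightarrow> (\<gamma> has_vector_derivative \<gamma>' x) (at x)"
    unfolding C1_differentiable_on_def by metis
  have tang: "linear_form (A (\<gamma> x)) (\<gamma>' x) = 0" if "x \<in> {0..1} - K" for x
    using path has_vector_derivative_at_within[OF \<gamma>'[OF that], of "{0..1}"] that
    by (auto simp: tangent_path_def one_form_eq_linear_form)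
  have nz: "A (\<gamma> x) \<noteq> 0" if "x \<in> {0..1}" for x using path that by (simp add: tangent_path_def)
  define T where "T = {x \<in> {0..1}. linear_form a (\<gamma> x) = 0}"
  have "continuous_on {0..1} (\<lambda>x. linear_form a (\<gamma> x))"
    unfolding linear_form_def by (intro continuous_intros cont)
  hence cl: "closedin (top_of_set {0..1}) T"
    unfolding T_def by (rule continuous_closedin_preimage_constant)
  have op: "openin (top_of_set {0..1}) T"
    unfolding openin_euclidean_subtopology_iff
  proof (intro conjI ballI)
    show "T \<subseteq> {0..1}" by (auto simp: T_def)
    fix x0 assume x0: "x0 \<in> T"
    hence "linear_form a (\<gamma> x0) = 0" "A (\<gamma> x0) \<noteq> 0" using nz by (auto simp: T_def)
    from loc[OF this] obtain V F where V: "open V" "\<gamma> x0 \<in> V" "F (\<gamma> x0) = (0::complex)"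
      "\<And>z. z \<in> V \<Longrightarrow> F z = 0 \<Longrightarrow> linear_form a z = 0"
      "\<And>z. z \<in> V \<Longrightarrow> \<exists>F'. (F has_derivative F') (at z) \<and> (\<forall>u. linear_form (A z) u = 0 \<longrightarrow> F' u = 0)"
      by metis
    obtain r where r: "r > 0" "ball (\<gamma> x0) r \<subseteq> V" using V(1,2) openE by blast
    obtain \<epsilon> where \<epsilon>: "\<epsilon> > 0" "\<And>x. x \<in> {0..1} \<Longrightarrow> dist x x0 < \<epsilon> \<Longrightarrow> dist (\<gamma> x) (\<gamma> x0) < r"
      using cont x0 r(1) unfolding continuous_on_iff T_def by blast
    define S where "S = {0..1} \<inter> ball x0 \<epsilon>"
    have SV: "\<gamma> x \<in> V" if "x \<in> S" for x
      using \<epsilon>(2)[of x] that r(2) by (auto simp: S_def dist_commute)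
    have contF: "continuous_on V F"
      using V(5) by (meson continuous_at_imp_continuous_on has_derivative_continuous)
    have h0: "F (\<gamma> x) = 0" if x: "x \<in> S" for x
    proof (rule has_derivative_zero_unique_strong_convex[where f = "\<lambda>x. F (\<gamma> x)" and S = S and K = K and c = x0])
      show "convex S" unfolding S_def by (intro convex_Int) auto
      show "continuous_on S (\<lambda>x. F (\<gamma> x))"
        using SV by (intro continuous_on_compose2[OF contF] continuous_on_subset[OF cont]) (auto simp: S_def)
      show "x0 \<in> S" using x0 \<epsilon> by (auto simp: S_def T_def)
      fix y assume y: "y \<in> S - K"
      obtain F' where F': "(F has_derivative F') (at (\<gamma> y))" "\<And>u. linear_form (A (\<gamma> y)) u = 0 \<Longrightarrow> F' u = 0"
        using V(5)[OF SV[of y]] y by auto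
      have yK: "y \<in> {0..1} - K" using y by (auto simp: S_def)
      have "((F \<circ> \<gamma>) has_vector_derivative F' (\<gamma>' y)) (at y within S)"
        by (rule vector_derivative_diff_chain_within[OF has_vector_derivative_at_within[OF \<gamma>'[OF yK]]
              has_derivative_at_withinI[OF F'(1)]])
      thus "((\<lambda>x. F (\<gamma> x)) has_derivative (\<lambda>h. 0)) (at y within S)"
        using F'(2)[OF tang[OF yK]] by (simp add: has_vector_derivative_def o_def)
    qed (use K V(3) x in auto)
    hence "x \<in> T" if "x \<in> {0..1}" "dist x x0 < \<epsilon>" for x
      using that V(4)[of "\<gamma> x"] SV[of x] by (auto simp: S_def T_def dist_commute)
    thus "\<exists>e>0. \<forall>x'\<in>{0..1}. dist x' x0 < e \<longrightarrow> x' \<in> T" using \<epsilon>(1) by blast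
  qed
  have "\<forall>T. openin (top_of_set {0..1::real}) T \<and> closedin (top_of_set {0..1}) T \<longrightarrow> T = {} \<or> T = {0..1}"
    using connected_Icc[of "0::real" 1] by (simp only: connected_clopen)
  from this[THEN spec, THEN mp, OF conjI[OF op cl]] have "T = {} \<or> T = {0..1}" .
  moreover have "0 \<in> T" using start by (simp add: T_def)
  ultimately have "t \<in> T" using t by blast
  thus ?thesis by (simp add: T_def)
qed

section \<open>The Lie algebra of tangent matrices\<close>

lemma hom_dir_add: "hom_dir k (u + v) = hom_dir k u + hom_dir k v"
  by (simp add: vec_eq_slot_iff[where k = k])

lemma hom_dir_scale: "hom_dir k (c *s v) = c *s hom_dir k v"
  by (simp add: vec_eq_slot_iff[where k = k])

lemma hom_coord_has_derivative:
  fixes k :: "('m::finite) option"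
  shows "((\<lambda>x. (B *v hom_coord k x) $ j) has_derivative (\<lambda>h. (B *v hom_dir k h) $ j)) (at x)"
proof -
  have "linear (\<lambda>h. (B *v hom_dir k h) $ j)"
    by (rule linearI)
      (simp_all add: scaleR_vec scaleR_conv_of_real[where 'a = complex] hom_dir_add hom_dir_scale
        matrix_vector_right_distrib vector_scalar_commute)
  hence "((\<lambda>x. (B *v hom_coord k 0) $ j + (B *v hom_dir k x) $ j) has_derivative
      (\<lambda>h. 0 + (B *v hom_dir k h) $ j)) (at x)"
    by (intro has_derivative_add has_derivative_const bounded_linear_imp_has_derivative)
      (simp add: linear_conv_bounded_linear)
  moreover have "(B *v hom_coord k x) $ j = (B *v hom_coord k 0) $ j + (B *v hom_dir k x) $ j"
    for x :: "complex^'m"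
    using hom_coord_line[of k 0 1 x]
    by (metis add_0 matrix_vector_right_distrib vec.scale_one vector_add_component)
  hence "(\<lambda>x. (B *v hom_coord k x) $ j) = (\<lambda>x. (B *v hom_coord k 0) $ j + (B *v hom_dir k x) $ j)"
    by (rule ext)
  ultimately show ?thesis by (simp only: add_0)
qed

lemma entire_linear_field: "entire_map (linear_field B k)"
  unfolding entire_map_def
proof (intro allI exI conjI)
  fix x
  let ?D = "\<lambda>v. \<chi> i. (B *v hom_dir k v) $ slot k i
     - (x $ i * (B *v hom_dir k v) $ k + v $ i * (B *v hom_coord k x) $ k)"
  show "Vector_Spaces.linear (*s) (*s) ?D"
    by (intro Vector_Spaces.linear_iff[THEN iffD2] conjI)
      (auto simp: vec_eq_iff hom_dir_add hom_dir_scale matrix_vector_right_distrib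
        vector_scalar_commute algebra_simps vec.vector_space_axioms)
  show "(linear_field B k has_derivative ?D) (at x)"
    by (rule has_derivative_vec_componentwise)
      (auto simp: linear_field_def intro!: has_derivative_diff has_derivative_mult hom_coord_has_derivative
        bounded_linear_imp_has_derivative bounded_linear_vec_nth)
qed

lemma linear_field_holo: "linear_field B \<in> holo_vector_fields"
  unfolding holo_vector_fields_def
proof (safe intro!: entire_linear_field)
  fix k l :: "'a option" and x :: "complex^'a" assume nz: "hom_coord k x $ l \<noteq> 0"
  show "linear_field B l (aff_coord l (hom_coord k x)) =
      dir_deriv (\<lambda>y. aff_coord l (hom_coord k y)) x (linear_field B k x)"
    using dir_deriv_aff_coord[of "mat 1" k x l "linear_field B k x"] nz
      linear_field_aff_coord[OF nz hom_dir_linear_field[of k B x]] by simp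
qed

lemma leaf_tangent_iff:
  "v \<in> leaf_tangent A k x \<longleftrightarrow> linear_form (A (hom_coord k x)) (hom_dir k v) = 0"
  by (simp add: leaf_tangent_def dir_deriv_hom_coord one_form_eq_linear_form)

lemma derived_series_decreasing:
  assumes L: "lie_subalgebra L"
  shows "derived_series L (Suc i) \<subseteq> derived_series L i"
proof (induction i)
  case 0
  have "vf.subspace L" "{vf_bracket X Y |X Y. X \<in> L \<and> Y \<in> L} \<subseteq> L"
    using L by (auto simp: lie_subalgebra_def)
  thus ?case by (simp add: vf.span_minimal)
next
  case (Suc i)
  show ?case
    unfolding derived_series.simps(2)[of L "Suc i"] derived_series.simps(2)[of L i]
    using Suc by (intro vf.span_mono) auto
qed

lemma linear_form_matrix: "linear_form a (B *v z) = linear_form (transpose B *v a) z"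
  by (simp add: linear_form_def matrix_vector_mult_def transpose_def sum_distrib_left sum_distrib_right)
    (subst sum.swap, simp add: mult_ac)

lemma proj_point_eq_range: "proj_point z = range (\<lambda>c. c *s z)"
  by (simp add: proj_point_def vec.span_singleton)

lemma proj_point_eqD:
  assumes "proj_point z = proj_point w" "z \<noteq> 0"
  shows "\<exists>c. c \<noteq> 0 \<and> z = c *s w"
proof -
  have "z \<in> proj_point z" unfolding proj_point_eq_range by (rule image_eqI[of _ _ 1]) auto
  hence "z \<in> proj_point w" using assms(1) by simp
  then obtain c where "z = c *s w" unfolding proj_point_eq_range by blast
  thus ?thesis using assms(2) by auto
qed

lemma proj_point_scale: "c \<noteq> 0 \<Longrightarrow> proj_point (c *s z) = proj_point z"
proof -
  assume c: "c \<noteq> 0"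
  have "d *s z \<in> range (\<lambda>e. e *s (c *s z))" for d
    by (rule image_eqI[of _ _ "d / c"]) (use c in simp_all)
  thus ?thesis by (auto simp: proj_point_eq_range)
qed

definition tangent_matrices :: "(complex^'n \<Rightarrow> complex^'n) \<Rightarrow> (complex^'n^'n) set" where
  "tangent_matrices A = {B. \<forall>z. linear_form (A z) (B *v z) = 0}"

context
  fixes A :: "complex^('m::finite) option \<Rightarrow> complex^'m option" and L :: "'m chart_field set"
  assumes LA: "L_foliation A L"
begin

lemma form_homogeneous: "\<exists>d. \<forall>c z. A (c *s z) = c ^ d *s A z"
proof -
  obtain d where "\<And>k. homogeneous_poly d (\<lambda>z. A z $ k)"
    using LA unfolding L_foliation_def foliation_def by blast
  from homogeneous_poly_scale[OF this] show ?thesis by (metis vec_eq_iff vector_smult_component)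
qed

lemma form_poly: "poly_fun (\<lambda>z. A z $ k)"
  using LA homogeneous_poly_imp_poly_fun unfolding L_foliation_def foliation_def by blast

lemma form_continuous: "continuous_on S A"
proof -
  have "continuous_on S (\<lambda>z. \<chi> k. A z $ k)"
    by (intro continuous_on_vec_lambda poly_fun_continuous form_poly)
  thus ?thesis by simp
qed

lemma form_euler: "linear_form (A z) z = 0"
  using LA by (simp add: L_foliation_def foliation_def linear_form_def mult.commute)

lemma form_scale_eq_0: "c \<noteq> 0 \<Longrightarrow> A (c *s z) = 0 \<longleftrightarrow> A z = 0"
  using form_homogeneous by force

lemma form_0: "A 0 = 0"
proof -
  obtain d where d: "\<And>c z. A (c *s z) = c ^ d *s A z" using form_homogeneous by blast
  show ?thesis
  proof (cases "d = 0")
    case True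
    have "linear_form (A 0) z = 0" for z
      using d[of 0 z] True form_euler[of z] by simp
    thus ?thesis using linear_form_eq_0_iff by blast
  next
    case False
    thus ?thesis using d[of 0 0] by (simp add: power_0_left)
  qed
qed

lemma proj_point_Sing_iff: "z \<noteq> 0 \<Longrightarrow> proj_point z \<in> Sing A \<longleftrightarrow> A z = 0"
proof
  assume z: "z \<noteq> 0" "proj_point z \<in> Sing A"
  then obtain w where "A w = 0" "proj_point z = proj_point w" by (auto simp: Sing_def)
  thus "A z = 0" using proj_point_eqD[OF _ z(1)] form_scale_eq_0 by metis
qed (auto simp: Sing_def)

text \<open>Since \<open>L\<close> consists of all fields tangent to the foliation, membership of a linear field in \<open>L\<close> is a
  condition on \<open>B\<close> alone; homogeneity carries it from the points \<open>hom_coord k x\<close> to all points.\<close>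

lemma tangent_matrices_iff: "B \<in> tangent_matrices A \<longleftrightarrow> linear_field B \<in> L"
proof -
  have L: "L = tangent_fields A" using LA by (simp add: L_foliation_def)
  have "linear_field B \<in> L \<longleftrightarrow> (\<forall>k x. linear_form (A (hom_coord k x)) (B *v hom_coord k x) = 0)"
    by (simp add: L tangent_fields_def linear_field_holo leaf_tangent_iff hom_dir_linear_field form_euler)
  moreover have "linear_form (A z) (B *v z) = 0"
    if h: "\<forall>k x. linear_form (A (hom_coord k x)) (B *v hom_coord k x) = 0" for z
  proof (cases "z = 0")
    case False
    then obtain k where k: "z $ k \<noteq> 0" by (auto simp: vec_eq_iff)
    define w where "w = hom_coord k (aff_coord k z)"
    have "z = z $ k *s w" using k by (simp add: w_def hom_aff)
    moreover have "linear_form (A (c *s w)) (B *v (c *s w)) = 0" for c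
      using form_homogeneous h by (auto simp: w_def linear_form_scale_left vector_scalar_commute)
    ultimately show ?thesis by metis
  qed simp
  ultimately show ?thesis by (auto simp: tangent_matrices_def)
qed

lemma tangent_matrices_linear: "X \<in> L \<Longrightarrow> \<exists>B\<in>tangent_matrices A. X = linear_field B"
  using holo_vector_fields_linear[of X] LA tangent_matrices_iff
  by (auto simp: L_foliation_def lie_subalgebra_def)

lemma tangent_matrices_comm: "B \<in> tangent_matrices A \<Longrightarrow> C \<in> tangent_matrices A \<Longrightarrow> B ** C - C ** B \<in> tangent_matrices A"
  using LA vf_bracket_linear_field[of C B] unfolding tangent_matrices_iff
  by (metis L_foliation_def lie_subalgebra_def)

text \<open>Transposing reverses products and hence only changes the sign of commutators. The last term of the
  derived series lifts to the matrices inducing the zero field, that is to the scalars, where the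
  chain in Lie's theorem may end.\<close>

lemma invariant_linear_form:
  assumes "solvable_lie L"
  shows "\<exists>a. a \<noteq> 0 \<and> (\<forall>B\<in>tangent_matrices A. \<exists>c. \<forall>z. linear_form a (B *v z) = c * linear_form a z)"
proof -
  obtain N where N: "derived_series L N = {0}" using assms by (auto simp: solvable_lie_def)
  define D where "D i = transpose ` {B. linear_field B \<in> derived_series L i}" for i
  have "\<exists>v. v \<noteq> 0 \<and> (\<forall>X\<in>D 0. \<exists>c. X *v v = c *s v)"
  proof (rule lie_common_eigenvector)
    fix i X Y assume "X \<in> D i" "Y \<in> D i"
    then obtain B C where BC: "X = transpose B" "Y = transpose C"
      "linear_field B \<in> derived_series L i" "linear_field C \<in> derived_series L i"
      by (auto simp: D_def)
    have "vf_bracket (linear_field B) (linear_field C) \<in> derived_series L (Suc i)"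
      unfolding derived_series.simps(2) using BC by (intro vf.span_base) blast
    hence "linear_field (C ** B - B ** C) \<in> derived_series L (Suc i)"
      by (simp add: vf_bracket_linear_field)
    moreover have "X ** Y - Y ** X = transpose (C ** B - B ** C)"
      by (simp add: BC matrix_transpose_mul[symmetric]) (simp add: transpose_def vec_eq_iff)
    ultimately show "X ** Y - Y ** X \<in> D (Suc i)" by (auto simp: D_def)
  next
    show "D (Suc i) \<subseteq> D i" for i
      using derived_series_decreasing[of L i] LA unfolding D_def L_foliation_def by blast
  next
    fix X assume "X \<in> D N"
    then obtain B where "X = transpose B" "linear_field B = 0" by (auto simp: D_def N)
    thus "\<exists>c. X = mat c" using linear_field_eq_0 transpose_mat by metis
  qed
  then obtain a where a: "a \<noteq> 0" "\<And>X. X \<in> D 0 \<Longrightarrow> \<exists>c. X *v a = c *s a" by blast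
  have "\<exists>c. \<forall>z. linear_form a (B *v z) = c * linear_form a z" if "B \<in> tangent_matrices A" for B
  proof -
    have "transpose B \<in> D 0" using that by (simp add: D_def tangent_matrices_iff)
    then obtain c where "transpose B *v a = c *s a" using a(2) by blast
    thus ?thesis by (auto simp: linear_form_matrix linear_form_scale_left)
  qed
  thus ?thesis using a(1) by blast
qed

text \<open>In an affine chart around \<open>z\<close> the values of \<open>L\<close> form a subspace of dimension \<open>n - 1\<close>, contained in
  the proper subspace cut out by \<open>b\<close>, hence equal to it. The radial direction, given by the scalar
  matrices, accounts for the remaining dimension upstairs.\<close>

lemma hyperplane_spanned:
  assumes reg: "regular_lie A L" and z: "A z \<noteq> 0"
    and b: "b \<noteq> 0" "linear_form b z = 0" "\<And>B. B \<in> tangent_matrices A \<Longrightarrow> linear_form b (B *v z) = 0"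
    and u: "linear_form b u = 0"
  shows "\<exists>C\<in>tangent_matrices A. u = C *v z"
proof -
  have "z \<noteq> 0" using z form_0 by auto
  then obtain k where k: "z $ k \<noteq> 0" by (auto simp: vec_eq_iff)
  define x where "x = aff_coord k z"
  define h where "h = hom_coord k x"
  have h: "h = (1 / z $ k) *s z" using k by (simp add: h_def x_def hom_aff)
  hence bh: "linear_form b h = 0" using b by simp
  have Ah: "A h \<noteq> 0" unfolding h using z k by (subst form_scale_eq_0) auto
  define W where "W = vf_values L k x"
  define T where "T = {v. linear_form b (hom_dir k v) = 0}"
  have "proj_point h \<in> CP - Sing A" using Ah proj_point_Sing_iff[of h] by (auto simp: CP_def h_def)
  hence dimW: "vec.dim W = CARD('m) - 1"
    using reg unfolding regular_lie_def W_def h_def by blast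
  have subL: "vf.subspace L" using LA unfolding L_foliation_def lie_subalgebra_def by blast
  have subW: "vec.subspace W"
  proof (rule vec.subspaceI)
    show "0 \<in> W"
      unfolding W_def vf_values_def using vf.subspace_0[OF subL] by (intro CollectI exI[of _ 0]) simp
    fix v assume "v \<in> W"
    then obtain X where X: "X \<in> L" "v = X k x" by (auto simp: W_def vf_values_def)
    show "c *s v \<in> W" for c
      unfolding W_def vf_values_def using vf.subspace_scale[OF subL X(1), of c] X(2)
      by (intro CollectI exI[of _ "vf_scale c X"]) (simp add: vf_scale_def)
    fix w assume "w \<in> W"
    then obtain Y where Y: "Y \<in> L" "w = Y k x" by (auto simp: W_def vf_values_def)
    show "v + w \<in> W"
      unfolding W_def vf_values_def using vf.subspace_add[OF subL X(1) Y(1)] X(2) Y(2)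
      by (intro CollectI exI[of _ "X + Y"]) simp
  qed
  have "hom_dir k (0 :: complex^'m) = 0" by (simp add: vec_eq_slot_iff[where k = k])
  hence subT: "vec.subspace T"
    by (auto simp: T_def vec.subspace_def hom_dir_add hom_dir_scale)
  have WT: "W \<subseteq> T"
  proof
    fix v assume "v \<in> W"
    then obtain X where "X \<in> L" "v = X k x" by (auto simp: W_def vf_values_def)
    then obtain B where B: "B \<in> tangent_matrices A" "v = linear_field B k x" using tangent_matrices_linear by blast
    have "linear_form b (B *v h) = 0" using b(3)[OF B(1)] by (simp add: h vector_scalar_commute)
    thus "v \<in> T" using bh by (simp add: T_def B(2) hom_dir_linear_field h_def[symmetric])
  qed
  have "T \<noteq> UNIV"
  proof
    assume "T = UNIV"
    hence T: "linear_form b (hom_dir k v) = 0" for v by (auto simp: T_def)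
    have "linear_form b w = 0" for w
    proof -
      define v where "v = (\<chi> i. (w - w $ k *s h) $ slot k i)"
      have "w = hom_dir k v + w $ k *s h"
        by (simp add: vec_eq_slot_iff[where k = k]) (simp add: v_def h_def)
      thus ?thesis using T[of v] bh by (metis linear_form_add linear_form_scale add_0 mult_zero_right)
    qed
    thus False using b(1) linear_form_eq_0_iff by blast
  qed
  hence "vec.dim T < vec.dim (UNIV :: (complex^'m) set)"
    using subT by (intro vec.dim_psubset) (simp add: vec.span_eq_iff[THEN iffD2] psubset_eq)
  hence "vec.dim T \<le> vec.dim W" unfolding dimW vec_dim_card by simp
  hence "W = T" using vec.subspace_dim_equal[OF subW subT WT] by simp
  define v where "v = (\<chi> i. (u - u $ k *s h) $ slot k i)"
  have v: "u = hom_dir k v + u $ k *s h"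
    by (simp add: vec_eq_slot_iff[where k = k]) (simp add: v_def h_def)
  hence "linear_form b (hom_dir k v) = 0" using u bh by (metis linear_form_add linear_form_scale add_0_right mult_zero_right)
  hence "v \<in> W" by (simp add: \<open>W = T\<close> T_def)
  then obtain X where "X \<in> L" "v = X k x" by (auto simp: W_def vf_values_def)
  then obtain B where B: "B \<in> tangent_matrices A" "v = linear_field B k x" using tangent_matrices_linear by blast
  \<comment> \<open>The scalar summand adjusts the radial component, the factor passes from the normalised point \<open>h\<close> to \<open>z\<close>.\<close>
  define C where "C = mat (1 / z $ k) ** (B + mat (u $ k - (B *v h) $ k))"
  have Cw: "C *v w = (1 / z $ k) *s (B *v w + (u $ k - (B *v h) $ k) *s w)" for w
    by (simp add: C_def matrix_vector_mul_assoc[symmetric] mat_mult_vec matrix_vector_mult_add_rdistrib)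
  have "C \<in> tangent_matrices A" using B(1) by (simp add: tangent_matrices_def Cw form_euler)
  moreover have "u = C *v z"
  proof -
    have "u = B *v h - (B *v h) $ k *s h + u $ k *s h"
      using v by (simp add: B(2) hom_dir_linear_field h_def[symmetric])
    also have "\<dots> = B *v h + (u $ k - (B *v h) $ k) *s h" by (simp add: vec.scale_left_diff_distrib)
    also have "\<dots> = C *v z" unfolding Cw by (simp add: h vector_scalar_commute vec.scale_right_distrib vec.scale_left_diff_distrib diff_divide_distrib mult_ac)
    finally show ?thesis .
  qed
  ultimately show ?thesis by blast
qed

end

section \<open>The invariant hyperplane\<close>

text \<open>One inclusion is the invariance of \<open>ker a\<close> under tangent paths; for the other, a line in \<open>ker a\<close> is
  followed along a path in the parameter plane that avoids the finitely many singular parameters.\<close>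

lemma is_leaf_hyperplane_section:
  fixes A :: "complex^('m::finite) option \<Rightarrow> complex^'m option"
  assumes LA: "L_foliation A L" and reg: "regular_lie A L" and a: "a \<noteq> 0"
    and inv: "\<And>B. B \<in> tangent_matrices A \<Longrightarrow> \<exists>c. \<forall>z. linear_form a (B *v z) = c * linear_form a z"
  defines "H \<equiv> {p \<in> CP. p \<subseteq> {z. (\<Sum>k\<in>UNIV. a $ k * z $ k) = 0}}"
  shows "is_leaf A (H - Sing A)"
proof -
  have inH: "proj_point z \<in> H \<longleftrightarrow> linear_form a z = 0" if "z \<noteq> 0" for z
  proof -
    have "proj_point z \<subseteq> {z. linear_form a z = 0} \<longleftrightarrow> linear_form a z = 0"
      unfolding proj_point_eq_range by (auto simp: image_subset_iff dest: spec[of _ 1])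
    thus ?thesis using that by (auto simp: H_def CP_def linear_form_def)
  qed
  have nz0: "z \<noteq> 0" if "A z \<noteq> 0" for z using that form_0[OF LA] by auto
  have span: "\<exists>C\<in>tangent_matrices A. u = C *v z"
    if "A z \<noteq> 0" "linear_form a z = 0" "linear_form a u = 0" for z u
  proof (rule hyperplane_spanned[OF LA reg that(1) a that(2) _ that(3)])
    fix B assume "B \<in> tangent_matrices A"
    then obtain c where "\<forall>z. linear_form a (B *v z) = c * linear_form a z" using inv by blast
    thus "linear_form a (B *v z) = 0" using that(2) by simp
  qed
  have kernel: "linear_form (A z) u = 0" if zu: "linear_form a z = 0" "linear_form a u = 0" for z u
  proof (cases "A z = 0")
    case False
    then obtain C where "C \<in> tangent_matrices A" "u = C *v z" using span[OF _ zu] by blast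
    thus ?thesis by (simp add: tangent_matrices_def)
  qed (simp add: linear_form_def)
  have "codim_ge 2 {z. A z = 0}" using LA by (simp add: L_foliation_def foliation_def)
  from codim_two_hyperplane[OF this a] obtain z0 where z0: "linear_form a z0 = 0" "A z0 \<noteq> 0" by blast
  have "leaf_through A (proj_point z0) = H - Sing A"
  proof (intro equalityI subsetI)
    fix p assume "p \<in> leaf_through A (proj_point z0)"
    then obtain \<gamma> where \<gamma>: "p = proj_point (pathfinish \<gamma>)" "tangent_path A \<gamma>"
      "proj_point (pathstart \<gamma>) = proj_point z0"
      by (auto simp: leaf_through_def)
    have nz: "\<gamma> 0 \<noteq> 0" "\<gamma> 1 \<noteq> 0" "A (\<gamma> 1) \<noteq> 0" using \<gamma>(2) by (auto simp: tangent_path_def)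
    obtain c where "\<gamma> 0 = c *s z0" using proj_point_eqD[of "\<gamma> 0" z0] \<gamma>(3) nz(1) by (auto simp: pathstart_def)
    hence start: "linear_form a (\<gamma> 0) = 0" using z0 by simp
    have "linear_form a (\<gamma> 1) = 0"
    proof (rule tangent_path_in_hyperplane[OF \<gamma>(2) start])
      fix z assume z: "linear_form a z = 0" "A z \<noteq> 0"
      show "\<exists>V F. open V \<and> z \<in> V \<and> F z = (0::complex) \<and> (\<forall>z\<in>V. F z = 0 \<longrightarrow> linear_form a z = 0) \<and>
        (\<forall>z\<in>V. \<exists>F'. (F has_derivative F') (at z) \<and> (\<forall>u. linear_form (A z) u = 0 \<longrightarrow> F' u = 0))"
        by (rule local_first_integral[where G = "tangent_matrices A"])
          (use form_continuous[OF LA] tangent_matrices_comm[OF LA] inv a z span in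
            \<open>auto simp: tangent_matrices_def\<close>)
    qed simp
    thus "p \<in> H - Sing A"
      using nz inH[of "\<gamma> 1"] proj_point_Sing_iff[OF LA, of "\<gamma> 1"] \<gamma>(1) by (simp add: pathfinish_def)
  next
    fix p assume p: "p \<in> H - Sing A"
    then obtain y where y: "p = proj_point y" "y \<noteq> 0" by (auto simp: H_def CP_def)
    hence ay: "linear_form a y = 0" "A y \<noteq> 0" using p inH[of y] proj_point_Sing_iff[OF LA, of y] by auto
    define v where "v = y - z0"
    define Z where "Z = {t. A (z0 + t *s v) = 0}"
    \<comment> \<open>One coefficient that is nonzero at \<open>z0\<close> bounds the number of singular parameters on the line.\<close>
    obtain j where j: "A z0 $ j \<noteq> 0" using z0(2) by (auto simp: vec_eq_iff)
    obtain P where P: "\<And>t. A (z0 + t *s v) $ j = poly P t"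
      using poly_fun_on_line[OF form_poly[OF LA, of j], of z0 v] by blast
    have "P \<noteq> 0" using P[of 0] j by auto
    moreover have "Z \<subseteq> {t. poly P t = 0}" using P by (auto simp: Z_def) (metis zero_index)
    ultimately have "finite Z" using poly_roots_finite finite_subset by blast
    hence "connected (UNIV - Z)" by (intro connected_open_delete_finite) (auto simp: convex_connected)
    moreover have "open (UNIV - Z)" using \<open>finite Z\<close> by (simp add: finite_imp_closed open_Diff)
    moreover have "0 \<in> UNIV - Z" "1 \<in> UNIV - Z" using z0 ay by (auto simp: Z_def v_def)
    ultimately obtain g where g: "polynomial_function g" "path_image g \<subseteq> UNIV - Z" "pathstart g = 0" "pathfinish g = 1"
      using connected_open_polynomial_connected[of "UNIV - Z" 0 1] by metis
    define \<gamma> where "\<gamma> t = z0 + g t *s v" for t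
    have "polynomial_function \<gamma>"
    proof -
      have "polynomial_function (\<lambda>c :: complex. c *s v)"
        by (rule polynomial_function_bounded_linear[OF bounded_linear_scale_vec])
      from polynomial_function_compose[OF g(1) this] show ?thesis
        unfolding \<gamma>_def by (intro polynomial_function_add polynomial_function_const) (simp add: o_def)
    qed
    have ker: "linear_form a (\<gamma> t) = 0" for t using z0 ay by (simp add: \<gamma>_def v_def)
    have "tangent_path A \<gamma>" unfolding tangent_path_def one_form_eq_linear_form
    proof (intro conjI ballI allI impI)
      show "valid_path \<gamma>" by (rule valid_path_polynomial_function) fact
    next
      fix t :: real assume t: "t \<in> {0..1}"
      hence "g t \<notin> Z" using g(2) t by (auto simp: path_image_def image_subset_iff)
      thus "A (\<gamma> t) \<noteq> 0" by (simp add: Z_def \<gamma>_def)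
      thus "\<gamma> t \<noteq> 0" by (rule nz0)
      fix w assume w: "(\<gamma> has_vector_derivative w) (at t within {0..1})"
      have "bounded_linear (linear_form a)"
        unfolding linear_conv_bounded_linear[symmetric]
        by (rule linearI) (simp_all add: scaleR_vec scaleR_conv_of_real[where 'a = complex])
      from bounded_linear.has_vector_derivative[OF this w]
      have d: "((\<lambda>t. 0) has_vector_derivative linear_form a w) (at t within {0..1})" by (simp add: ker)
      have d0: "((\<lambda>t. 0 :: complex) has_vector_derivative 0) (at t within {0..1})" by simp
      have "linear_form a w = 0"
        using vector_derivative_unique_within_closed_interval[of 0 1 t "\<lambda>t. 0" "linear_form a w" 0]
          t d d0 by simp
      thus "linear_form (A (\<gamma> t)) w = 0" using kernel[OF ker] by blast
    qed
    moreover have "pathstart \<gamma> = z0" "pathfinish \<gamma> = y"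
      using g(3,4) by (simp_all add: pathstart_def pathfinish_def \<gamma>_def v_def)
    ultimately show "p \<in> leaf_through A (proj_point z0)" unfolding leaf_through_def y(1) by force
  qed
  moreover have "proj_point z0 \<in> CP - Sing A"
    using z0 nz0 proj_point_Sing_iff[OF LA, of z0] by (auto simp: CP_def)
  ultimately show ?thesis unfolding is_leaf_def by metis
qed

lemma hyperplane_at_infinity_matrix:
  fixes a :: "complex^('m::finite) option"
  assumes "a \<noteq> 0"
  shows "\<exists>M N :: complex^'m option^'m option. M ** N = mat 1 \<and> N ** M = mat 1 \<and> (\<forall>z. (N *v z) $ None = linear_form a z)"
proof -
  obtain k where k: "a $ k \<noteq> 0" using assms by (auto simp: vec_eq_iff)
  \<comment> \<open>The new coordinates are \<open>a\<close> itself and all old ones except \<open>z\<^sub>k\<close>, where \<open>a\<^sub>k \<noteq> 0\<close>.\<close>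
  define N :: "complex^'m option^'m option" where
    "N = (\<chi> r. case r of None \<Rightarrow> a | Some i \<Rightarrow> axis (slot k i) 1)"
  have N: "(N *v z) $ r = linear_form (N $ r) z" for z r
    by (simp add: matrix_vector_mult_def linear_form_def)
  have "z = 0" if Nz: "N *v z = 0" for z
  proof -
    have "linear_form (axis j 1) z = z $ j" for j
      by (simp add: linear_form_def axis_def if_distrib if_distribR cong: if_cong)
    hence z: "z $ slot k i = 0" for i
      using N[of z "Some i"] Nz by (simp add: N_def)
    hence "z = axis k (z $ k)" by (simp add: vec_eq_slot_iff[where k = k]) (simp add: axis_def)
    moreover have "linear_form a z = 0" using N[of z None] Nz by (simp add: N_def)
    ultimately have "a $ k * z $ k = 0" by (metis linear_form_axis)
    thus ?thesis using k z by (simp add: vec_eq_slot_iff[where k = k])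
  qed
  hence "\<exists>M. M ** N = mat 1"
    unfolding matrix_left_invertible_injective vec.inj_iff_eq_0 by blast
  then obtain M where "M ** N = mat 1" by blast
  moreover from this have "N ** M = mat 1" using matrix_left_right_inverse by blast
  moreover have "(N *v z) $ None = linear_form a z" for z using N[of z None] by (simp add: N_def)
  ultimately show ?thesis by blast
qed

lemma affine_chart_hyperplane:
  fixes a :: "complex^('m::finite) option"
  assumes MN: "M ** N = mat 1" "N ** M = mat 1" and N: "\<And>z. (N *v z) $ None = linear_form a z"
  shows "affine_chart_onto M (CP - {p \<in> CP. p \<subseteq> {z. (\<Sum>k\<in>UNIV. a $ k * z $ k) = 0}})"
proof -
  have MNv: "M *v (N *v z) = z" "N *v (M *v z) = z" for z
    by (simp_all add: matrix_vector_mul_assoc MN)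
  define H where "H = {p \<in> CP. p \<subseteq> {z. (\<Sum>k\<in>UNIV. a $ k * z $ k) = 0}}"
  have inH: "proj_point z \<in> CP - H \<longleftrightarrow> linear_form a z \<noteq> 0" if "z \<noteq> 0" for z
  proof -
    have "proj_point z \<subseteq> {z. linear_form a z = 0} \<longleftrightarrow> linear_form a z = 0"
      unfolding proj_point_eq_range by (auto simp: image_subset_iff dest: spec[of _ 1])
    thus ?thesis using that by (auto simp: H_def CP_def linear_form_def)
  qed
  have aM: "linear_form a (affine_param M x) = 1" for x
    by (simp add: affine_param_def N[symmetric] MNv)
  have nz: "affine_param M x \<noteq> 0" for x using aM[of x] by auto
  have "bij_betw (\<lambda>x. proj_point (affine_param M x)) UNIV (CP - H)"
  proof (rule bij_betw_imageI)
    show "inj (\<lambda>x. proj_point (affine_param M x))"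
    proof (rule injI)
      fix x y assume "proj_point (affine_param M x) = proj_point (affine_param M y)"
      then obtain c where c: "affine_param M x = c *s affine_param M y" using proj_point_eqD[OF _ nz] by blast
      hence "c = 1" using aM[of x] aM[of y] by simp
      hence "N *v affine_param M x = N *v affine_param M y" using c by simp
      hence "hom_coord None x = hom_coord None y" by (simp add: affine_param_def MNv)
      thus "x = y" by (metis aff_hom)
    qed
    show "range (\<lambda>x. proj_point (affine_param M x)) = CP - H"
    proof (intro equalityI subsetI)
      fix p assume "p \<in> CP - H"
      then obtain z where z: "p = proj_point z" "z \<noteq> 0" by (auto simp: CP_def)
      hence az: "linear_form a z \<noteq> 0" using inH \<open>p \<in> CP - H\<close> by blast
      define w where "w = (1 / linear_form a z) *s z"
      have "(N *v w) $ None = 1" using az by (simp add: N w_def)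
      hence "hom_coord None (aff_coord None (N *v w)) = N *v w" by (simp add: hom_aff)
      hence "affine_param M (aff_coord None (N *v w)) = w" by (simp add: affine_param_def MNv)
      moreover have "proj_point w = p" unfolding w_def z(1) using az by (intro proj_point_scale) simp
      ultimately show "p \<in> range (\<lambda>x. proj_point (affine_param M x))" by (metis rangeI)
    qed (use inH[OF nz] aM in auto)
  qed
  moreover have "invertible M" using MN by (auto simp: invertible_def)
  ultimately show ?thesis by (simp add: affine_chart_onto_def H_def)
qed

text \<open>In the new coordinates the matrix of the field is \<open>N B M\<close>. It has first row \<open>(c, 0, \<dots>, 0)\<close>, which removes the
  quadratic part of the field.\<close>

lemma linear_field_affine_expression:
  assumes MN: "M ** N = mat 1" "N ** M = mat 1" and N: "\<And>z. (N *v z) $ None = linear_form a z"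
    and c: "\<And>z. linear_form a (B *v z) = c * linear_form a z"
  shows "\<exists>Y. expressed_as M (linear_field B) Y \<and> affine_field Y"
proof (intro exI conjI)
  have MNv: "M *v (N *v z) = z" "N *v (M *v z) = z" for z
    by (simp_all add: matrix_vector_mul_assoc MN)
  let ?B = "N ** B ** M"
  have Bv: "?B *v z = N *v (B *v (M *v z))" for z
    by (simp add: matrix_vector_mul_assoc matrix_mul_assoc)
  show "expressed_as M (linear_field B) (linear_field ?B None)"
    unfolding expressed_as_def affine_param_def
  proof (intro allI impI)
    fix k x assume nz: "(M *v hom_coord None x) $ k \<noteq> 0"
    let ?w = "M *v hom_coord None x"
    have u: "M *v hom_dir None (linear_field ?B None x) = B *v ?w - (?B *v hom_coord None x) $ None *s ?w"
      by (simp add: hom_dir_linear_field matrix_vector_mult_diff_distrib vector_scalar_commute)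
        (simp add: Bv MNv)
    show "linear_field B k (aff_coord k ?w) =
        dir_deriv (\<lambda>y. aff_coord k (M *v hom_coord None y)) x (linear_field ?B None x)"
      unfolding dir_deriv_aff_coord[OF nz] by (rule linear_field_aff_coord[OF nz u])
  qed
  show "affine_field (linear_field ?B None)"
    unfolding affine_field_def
  proof (intro exI allI)
    fix x
    have "(?B *v hom_coord None x) $ None = c"
    proof -
      have "linear_form a (M *v hom_coord None x) = 1" by (simp add: N[symmetric] MNv)
      thus ?thesis by (simp add: Bv N c)
    qed
    moreover have "(?B *v hom_coord None x) $ Some i = ?B $ Some i $ None + (\<Sum>j\<in>UNIV. ?B $ Some i $ Some j * x $ j)" for i
      unfolding matrix_vector_mult_def by (simp add: sum_option)
    ultimately show "linear_field ?B None x =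
        ((\<chi> i j. ?B $ Some i $ Some j) - mat c) *v x + (\<chi> i. ?B $ Some i $ None)"
      by (simp add: vec_eq_iff linear_field_def matrix_vector_mult_diff_rdistrib mat_mult_vec)
        (simp add: matrix_vector_mult_def mult.commute)
  qed
qed

theorem mainTheorem9:
  fixes A :: "complex^('m::finite) option \<Rightarrow> complex^'m option"
    and L :: "'m chart_field set"
  assumes "L_foliation A L"
    and "regular_lie A L"
    and "solvable_lie L"
  shows "\<exists>H. invariant_hyperplane A H \<and>
           (\<exists>M. affine_chart_onto M (CP - H) \<and>
              (\<forall>X\<in>L. \<exists>Y. expressed_as M X Y \<and> affine_field Y))"
proof -
  obtain a where a: "a \<noteq> 0"
    and inv: "\<And>B. B \<in> tangent_matrices A \<Longrightarrow> \<exists>c. \<forall>z. linear_form a (B *v z) = c * linear_form a z"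
    using invariant_linear_form[OF assms(1,3)] by blast
  define H where "H = {p \<in> CP. p \<subseteq> {z. (\<Sum>k\<in>UNIV. a $ k * z $ k) = 0}}"
  have "is_leaf A (H - Sing A)"
    unfolding H_def by (rule is_leaf_hyperplane_section[OF assms(1,2) a inv])
  hence "invariant_hyperplane A H"
    using a unfolding invariant_hyperplane_def hyperplane_def H_def by blast
  moreover obtain M N :: "complex^'m option^'m option" where MN: "M ** N = mat 1" "N ** M = mat 1" "\<And>z. (N *v z) $ None = linear_form a z"
    using hyperplane_at_infinity_matrix[OF a] by blast
  have "affine_chart_onto M (CP - H)"
    unfolding H_def by (rule affine_chart_hyperplane[OF MN])
  moreover have "\<exists>Y. expressed_as M X Y \<and> affine_field Y" if XL: "X \<in> L" for X
  proof -
    obtain B where B: "B \<in> tangent_matrices A" "X = linear_field B"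
      using tangent_matrices_linear[OF assms(1) XL] by blast
    then obtain c where "\<And>z. linear_form a (B *v z) = c * linear_form a z" using inv by blast
    from linear_field_affine_expression[OF MN this] show ?thesis by (simp add: B(2))
  qed
  ultimately show ?thesis by blast
qed

end
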